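(* Let $\nu>0$ and let $k$ be a positive integer with $0<k<\nu$. Let $\mu\in\mathbb{R}$ and $\sigma>0$. Write $St(t\,|\,\mu,\sigma,\nu)$ for the location-scale Student's t-distribution with the density given in the context. Then the following hold. (1) If $T\sim St(t\,|\,0,1,\nu)$, the raw and absolute moments satisfy $$\mathbb{E}(T^k)=\begin{cases}\dfrac{\Gamma(\frac{k+1}{2})}{\sqrt{\pi}}\cdot\dfrac{\nu^{k/2}}{\prod_{i=1}^{k/2}\left(\frac{\nu}{2}-i\right)}, & k\text{ even},\\[2ex] 0, & k\text{ odd},\end{cases}$$ and $$\mathbb{E}(|T|^k)=\frac{\nu^{k/2}\,\Gamma(\frac{k+1}{2})\,\Gamma(\frac{\nu-k}{2})}{\sqrt{\pi}\,\Gamma(\frac{\nu}{2})}.$$ (2) If $T\sim St(t\,|\,\mu,\sigma,\nu)$, the raw moments and central moments satisfy $$\mathbb{E}(T^k)=\begin{cases}\left(\frac{\nu}{\sigma}\right)^{k/2}\dfrac{\Gamma(\frac{k+1}{2})}{\sqrt{\pi}}\,\dfrac{\Gamma(\frac{\nu}{2}-\frac{k}{2})}{\Gamma(\frac{\nu}{2})}\;{}_2F_1\!\left(-\frac{k}{2},\frac{\nu}{2}-\frac{k}{2},\frac12;-\frac{\mu^2\sigma}{\nu}\right), & k\text{ even},\\[2ex] 2\mu\left(\frac{\nu}{\sigma}\right)^{(k-1)/2}\dfrac{\Gamma(\frac{k}{2}+1)}{\sqrt{\pi}}\,\dfrac{\Gamma(\frac{\nu}{2}-\frac{k-1}{2})}{\Gamma(\frac{\nu}{2})}\;{}_2F_1\!\left(\frac{1-k}{2},\frac{\nu}{2}-\frac{k-1}{2},\frac32;-\frac{\mu^2\sigma}{\nu}\right),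 & k\text{ odd},\end{cases}$$ and $$\mathbb{E}\big((T-\mu)^k\big)=\frac{1+(-1)^k}{2}\left(\frac{\nu}{\sigma}\right)^{k/2}\frac{\Gamma(\frac{k+1}{2})}{\sqrt{\pi}}\,\frac{\Gamma(\frac{\nu-k}{2})}{\Gamma(\frac{\nu}{2})}.$$ (3) If $T\sim St(t\,|\,\mu,\sigma,\nu)$, the absolute moments and absolute central moments satisfy $$\mathbb{E}(|T|^k)=\left(\frac{\nu}{\sigma}\right)^{k/2}\frac{\Gamma(\frac{k+1}{2})}{\sqrt{\pi}}\,\frac{\Gamma(\frac{\nu}{2}-\frac{k}{2})}{\Gamma(\frac{\nu}{2})}\;{}_2F_1\!\left(-\frac{k}{2},\frac{\nu}{2}-\frac{k}{2},\frac12;-\frac{\mu^2\sigma}{\nu}\right)$$ and $$\mathbb{E}(|T-\mu|^k)=\left(\frac{\nu}{\sigma}\right)^{k/2}\frac{\Gamma(\frac{k+1}{2})}{\sqrt{\pi}}\,\frac{\Gamma(\frac{\nu-k}{2})}{\Gamma(\frac{\nu}{2})}.$$ In general, the moments are undefined when $k\ge\nu$.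
   Context: For $\mu\in\mathbb{R}$, $\sigma>0$, $\nu>0$, the location-scale (generalized) Student's t-distribution $St(t\,|\,\mu,\sigma,\nu)$ with $\nu$ degrees of freedom is the probability distribution on $\mathbb{R}$ with density $$St(t\,|\,\mu,\sigma,\nu)=\frac{\Gamma(\frac{\nu+1}{2})}{\Gamma(\frac{\nu}{2})}\left(\frac{\sigma}{\nu\pi}\right)^{1/2}\left(1+\frac{\sigma}{\nu}(t-\mu)^2\right)^{-\frac{\nu+1}{2}},\qquad t\in\mathbb{R}.$$ The choice $\mu=0$, $\sigma=1$ gives the standard Student's t-distribution. $\Gamma(z)=\int_0^\infty t^{z-1}e^{-t}\,dt$ is the Gamma function. The hypergeometric function is defined by $${}_2F_1(a,b,c;z)=\sum_{n=0}^{\infty}\frac{a^{\overline{n}}\,b^{\overline{n}}}{c^{\overline{n}}}\cdot\frac{z^n}{n!},$$ where $a^{\overline{n}}=\Gamma(a+n)/\Gamma(a)$ is the rising factorial: $a^{\overline{0}}=1$ and $a^{\overline{n}}=a(a+1)\cdots(a+n-1)$ for $n>0$.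
   Formalization: In (3) with k odd, the series defining 2F1 diverges when μ²σ/ν > 1, so the formula as given is undefined there; 2F1 is taken as the series where it converges and otherwise as its analytic continuation to the complex plane minus [1,∞). *)

theory Defs
  imports "HOL-Probability.Probability" "HOL-Complex_Analysis.Complex_Analysis"
begin

definition student_t_density :: "real \<Rightarrow> real \<Rightarrow> real \<Rightarrow> real \<Rightarrow> real" where
  "student_t_density \<mu> \<sigma> \<nu> t =
     Gamma ((\<nu> + 1) / 2) / Gamma (\<nu> / 2) * sqrt (\<sigma> / (\<nu> * pi)) *
     (1 + \<sigma> / \<nu> * (t - \<mu>)\<^sup>2) powr (- ((\<nu> + 1) / 2))"

definition hyp2F1_term :: "complex \<Rightarrow> complex \<Rightarrow> complex \<Rightarrow> complex \<Rightarrow> nat \<Rightarrow> complex" where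
  "hyp2F1_term a b c z n =
     pochhammer a n * pochhammer b n / pochhammer c n * (z ^ n / fact n)"

(* The Gauss hypergeometric function: the sum of its defining series wherever that series
   converges (in particular for every z when a or b is a non-positive integer), and
   elsewhere, as is customary, the principal branch: the analytic continuation from the
   unit disc to the complex plane cut along [1, \<infinity>).  The description operator ranges over
   values w and not over functions f, because f is unconstrained on the cut; by the
   identity theorem w is unique for z off the cut.  Without the second case the function
   would be an arbitrary default value for a non-terminating series at z < -1. *)
definition hyp2F1 :: "complex \<Rightarrow> complex \<Rightarrow> complex \<Rightarrow> complex \<Rightarrow> complex" where
  "hyp2F1 a b c z =
     (if summable (hyp2F1_term a b c z) then (\<Sum>n. hyp2F1_term a b c z n)
      else (THE w. \<exists>f. f holomorphic_on (- complex_of_real ` {1..}) \<and>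
                       (\<forall>u\<in>ball 0 1. hyp2F1_term a b c u sums f u) \<and> f z = w))"

end

theory Submission
  imports Defs
begin

text \<open>
  Put \<open>d = \<nu> / \<sigma>\<close>, \<open>p = (\<nu> + 1) / 2\<close> and \<open>b = (\<nu> - k) / 2\<close>. Up to a constant the density is
  \<open>(d + (t - \<mu>)\<^sup>2) powr (- p)\<close>, so everything comes down to the absolute moment of this kernel.

  Fold the integral of \<open>\<bar>t\<bar> ^ k * (d + (t - \<mu>)\<^sup>2) powr (- p)\<close> onto the half line and write
  \<open>d + (t \<mp> \<mu>)\<^sup>2 = (A + t\<^sup>2) \<mp> 2 * \<mu> * t\<close> with \<open>A = d + \<mu>\<^sup>2\<close>. Since \<open>\<bar>2 * \<mu> * t\<bar> < A + t\<^sup>2\<close>, the binomial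
  series applies to both terms; the odd powers cancel and what is left is a series of nonnegative
  functions, which may be integrated term by term for every \<open>\<mu>\<close>. Each term is a Beta integral
  (\<open>half_line_beta_integral\<close>), and the sum is the hypergeometric series with parameters
  \<open>(k + 1) / 2\<close>, \<open>b\<close>, \<open>1 / 2\<close> at the point \<open>\<mu>\<^sup>2 / A\<close> of \<open>[0, 1)\<close>
  (\<open>nn_integral_abs_moment_kernel\<close>). With \<open>z = - \<mu>\<^sup>2 / d\<close> this point is \<open>z / (z - 1)\<close>, so Pfaff's
  transformation \<open>F(c - e, b; c; z) = (1 - z) powr (- b) * F(e, b; c; z / (z - 1))\<close> turns the result
  into the stated value of the hypergeometric function at \<open>z\<close> (\<open>abs_moment_kernel\<close>).

  For odd \<open>k\<close> the series at \<open>z\<close> does not terminate, and it diverges as soon as \<open>z < - 1\<close>; there the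
  claim is about the analytic continuation to the plane cut along \<open>[1, \<infinity>)\<close>. The continuation exists
  by Euler's integral when \<open>c > b\<close>; the remaining cases follow from the operator
  \<open>f \<mapsto> f + z * f' / c\<close>, which lowers the third parameter from \<open>c + 1\<close> to \<open>c\<close>
  (\<open>hyp2F1_analytic_continuation\<close>). Where the series converges outside the open unit disc, Abel's limit
  theorem shows that its sum is the value of the continuation (\<open>hyp2F1_eq_continuation\<close>). Pfaff's
  transformation is the Chu--Vandermonde identity for coefficients near 0 and extends by the
  identity theorem to the half plane \<open>Re z < 1 / 2\<close>, which contains the negative axis.

  The case \<open>\<mu> = 0\<close> gives the absolute central moments; the odd central moments vanish by symmetry.
  Even raw moments are absolute moments. Odd raw moments are obtained from the central ones by the
  binomial theorem, because their hypergeometric series is a polynomial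
  (\<open>student_t_odd_moment\<close>). For \<open>k \<ge> \<nu>\<close> the integrand dominates a multiple of \<open>1 / s\<close> at infinity.
\<close>

section \<open>The plane cut along the ray from 1 to infinity\<close>

definition cut_plane :: "complex set" where
  "cut_plane = - complex_of_real ` {1..}"

lemma open_cut_plane: "open cut_plane"
proof -
  have "closed (complex_of_real ` {1..})"
    by (intro closed_injective_linear_image) (auto intro: linear_of_real inj_of_real)
  then show ?thesis by (simp add: cut_plane_def open_Compl)
qed

lemma mem_cut_plane_iff: "z \<in> cut_plane \<longleftrightarrow> Im z \<noteq> 0 \<or> Re z < 1"
  unfolding cut_plane_def by (auto simp: image_iff complex_eq_iff)

text \<open>
  This keeps the integrand \<open>(1 - z * t) powr (- a)\<close> of Euler's integral away from the branch cut of
  the power for all \<open>t\<close> in the unit interval.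
\<close>
lemma scaled_cut_plane_avoids_nonpos:
  assumes "z \<in> cut_plane" "0 \<le> t" "t \<le> 1"
  shows "1 - z * complex_of_real t \<notin> \<real>\<^sub>\<le>\<^sub>0"
proof
  assume "1 - z * complex_of_real t \<in> \<real>\<^sub>\<le>\<^sub>0"
  then have 1: "Re z * t \<ge> 1" and 2: "Im z * t = 0"
    by (auto simp: complex_nonpos_Reals_iff)
  from 1 assms have t: "t \<noteq> 0" by auto
  with 2 have "Im z = 0" by simp
  moreover have "Re z \<ge> 1"
  proof (rule ccontr)
    assume "\<not> Re z \<ge> 1"
    then have "Re z * t < 1 * t" using t assms by (intro mult_strict_right_mono) auto
    with 1 assms show False by simp
  qed
  ultimately show False using assms by (auto simp: mem_cut_plane_iff)
qed

section \<open>Analytic continuation of the hypergeometric series\<close>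

text \<open>
  Difference quotients are bounded, locally uniformly in \<open>z\<close>, by a bound of the continuous
  derivative on a compact set. A constant is integrable for a finite measure, so dominated convergence
  allows differentiation under the integral.
\<close>
lemma holomorphic_on_parameter_integral:
  fixes h h' :: "complex \<Rightarrow> real \<Rightarrow> complex" and a b :: real
  assumes "finite_measure N" and sets_N: "sets N = sets (restrict_space borel {a..b})"
    and "open S"
    and deriv: "\<And>z t. z \<in> S \<Longrightarrow> t \<in> {a..b} \<Longrightarrow> ((\<lambda>z. h z t) has_field_derivative h' z t) (at z)"
    and cont: "\<And>z. z \<in> S \<Longrightarrow> continuous_on {a..b} (h z)"
    and cont': "continuous_on (S \<times> {a..b}) (\<lambda>(z,t). h' z t)"
  shows "(\<lambda>z. \<integral>t. h z t \<partial>N) holomorphic_on S"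
proof -
  interpret finite_measure N by fact
  have space_N: "space N = {a..b}"
    using sets_eq_imp_space_eq[OF sets_N] by (simp add: space_restrict_space)
  have meas: "f \<in> borel_measurable N" if "continuous_on {a..b} f" for f :: "real \<Rightarrow> complex"
    using borel_measurable_continuous_on_restrict[OF that] measurable_cong_sets[OF sets_N refl] by blast
  have int: "integrable N f" if f: "continuous_on {a..b} f" for f :: "real \<Rightarrow> complex"
  proof -
    have "bounded (f ` {a..b})"
      by (rule compact_imp_bounded[OF compact_continuous_image[OF f compact_Icc]])
    then obtain C where "\<And>t. t \<in> {a..b} \<Longrightarrow> norm (f t) \<le> C"
      unfolding bounded_iff by blast
    then show ?thesis
      by (intro integrable_const_bound[of _ C] meas f) (auto intro!: AE_I2 simp: space_N)
  qed
  have "\<exists>D. ((\<lambda>z. \<integral>t. h z t \<partial>N) has_field_derivative D) (at z0)" if z0: "z0 \<in> S" for z0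
  proof -
    obtain r where r: "r > 0" "cball z0 r \<subseteq> S"
      using \<open>open S\<close> z0 open_contains_cball by blast
    have cpt: "compact (cball z0 r \<times> {a..b})" by (intro compact_Times compact_cball compact_Icc)
    have cts: "continuous_on (cball z0 r \<times> {a..b}) (\<lambda>(z,t). h' z t)"
      by (rule continuous_on_subset[OF cont']) (use r in auto)
    obtain C where bd: "\<forall>p\<in>cball z0 r \<times> {a..b}. norm ((\<lambda>(z,t). h' z t) p) \<le> C"
      using compact_imp_bounded[OF compact_continuous_image[OF cts cpt]]
      unfolding bounded_iff ball_simps by blast
    have C: "norm (h' z t) \<le> C" if "z \<in> cball z0 r" "t \<in> {a..b}" for z t
      using bspec[OF bd, of "(z, t)"] that by simp
    have lip: "norm (h z t - h z0 t) \<le> C * norm (z - z0)" if "z \<in> ball z0 r" "t \<in> {a..b}" for z t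
    proof (rule field_differentiable_bound[of "cball z0 r" "\<lambda>z. h z t" "\<lambda>z. h' z t"])
      fix w assume "w \<in> cball z0 r"
      then have "((\<lambda>z. h z t) has_field_derivative h' w t) (at w)"
        by (intro deriv subsetD[OF r(2)] that(2))
      then show "((\<lambda>z. h z t) has_field_derivative h' w t) (at w within cball z0 r)"
        by (rule has_field_derivative_at_within)
    qed (use C that r in auto)
    have cont'0: "continuous_on {a..b} (h' z0)"
    proof -
      have "continuous_on {a..b} ((\<lambda>(z,t). h' z t) \<circ> Pair z0)"
        by (intro continuous_on_compose continuous_intros continuous_on_subset[OF cont'])
           (use z0 in auto)
      then show ?thesis by (simp add: o_def)
    qed
    have "((\<lambda>z. ((\<integral>t. h z t \<partial>N) - (\<integral>t. h z0 t \<partial>N)) / (z - z0)) \<longlongrightarrow> (\<integral>t. h' z0 t \<partial>N))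
            (at z0 within ball z0 r)"
      unfolding tendsto_at_iff_sequentially
    proof (intro allI impI)
      fix X :: "nat \<Rightarrow> complex"
      assume X: "\<forall>i. X i \<in> ball z0 r - {z0}" "X \<longlonglongrightarrow> z0"
      have XS: "X i \<in> S" for i using X(1) r by (metis DiffD1 ball_subset_cball in_mono)
      have eq: "((\<integral>t. h (X n) t \<partial>N) - (\<integral>t. h z0 t \<partial>N)) / (X n - z0)
          = (\<integral>t. (h (X n) t - h z0 t) / (X n - z0) \<partial>N)" for n
        using int[OF cont[OF XS[of n]]] int[OF cont[OF z0]] by simp
      have "(\<lambda>n. \<integral>t. (h (X n) t - h z0 t) / (X n - z0) \<partial>N) \<longlonglongrightarrow> (\<integral>t. h' z0 t \<partial>N)"
      proof (rule integral_dominated_convergence[where w = "\<lambda>_. C"])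
        show "h' z0 \<in> borel_measurable N" by (intro meas cont'0)
        show "(\<lambda>t. (h (X n) t - h z0 t) / (X n - z0)) \<in> borel_measurable N" for n
          using X(1) by (intro meas continuous_intros cont XS z0) auto
        show "AE t in N. (\<lambda>n. (h (X n) t - h z0 t) / (X n - z0)) \<longlonglongrightarrow> h' z0 t"
        proof (rule AE_I2)
          fix t assume "t \<in> space N"
          then have "((\<lambda>z. h z t) has_field_derivative h' z0 t) (at z0)"
            using deriv z0 space_N by auto
          then have "((\<lambda>z. (h z t - h z0 t) / (z - z0)) \<longlongrightarrow> h' z0 t) (at z0)"
            by (simp add: has_field_derivative_iff)
          then show "(\<lambda>n. (h (X n) t - h z0 t) / (X n - z0)) \<longlonglongrightarrow> h' z0 t"
            unfolding tendsto_at_iff_sequentially using X by (auto simp: o_def)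
        qed
        show "AE t in N. norm ((h (X n) t - h z0 t) / (X n - z0)) \<le> C" for n
          using X(1) lip[of "X n"] space_N
          by (intro AE_I2) (auto simp: norm_divide divide_simps mult.commute)
      qed simp
      then show "((\<lambda>z. ((\<integral>t. h z t \<partial>N) - (\<integral>t. h z0 t \<partial>N)) / (z - z0)) \<circ> X)
          \<longlonglongrightarrow> (\<integral>t. h' z0 t \<partial>N)"
        by (simp add: o_def eq)
    qed
    then have "((\<lambda>z. \<integral>t. h z t \<partial>N) has_field_derivative (\<integral>t. h' z0 t \<partial>N)) (at z0 within ball z0 r)"
      by (simp add: has_field_derivative_iff)
    then show ?thesis
      using r by (metis at_within_open centre_in_ball open_ball)
  qed
  then show ?thesis
    by (simp add: holomorphic_on_open[OF \<open>open S\<close>])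
qed

lemma continuous_on_powr_const:
  fixes g :: "'a::topological_space \<Rightarrow> complex"
  assumes "continuous_on A g" "\<And>x. x \<in> A \<Longrightarrow> g x \<notin> \<real>\<^sub>\<le>\<^sub>0"
  shows "continuous_on A (\<lambda>x. g x powr w)"
proof -
  have "continuous_on A (\<lambda>x. exp (w * Ln (g x)))"
    using assms by (intro continuous_intros) auto
  also have "?this \<longleftrightarrow> ?thesis"
    using assms(2) by (intro continuous_on_cong refl) (simp add: powr_def, metis nonpos_Reals_zero_I)
  finally show ?thesis .
qed

lemma binomial_series_complex:
  fixes a z :: complex
  assumes "norm z < 1"
  shows "(\<lambda>n. pochhammer a n / fact n * z ^ n) sums ((1 - z) powr (- a))"
proof -
  have "(\<lambda>n. ((-a) gchoose n) * (-z) ^ n) sums (1 + (-z)) powr (-a)"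
    by (rule gen_binomial_complex) (use assms in simp)
  moreover have "((-a) gchoose n) * (-z) ^ n = pochhammer a n / fact n * z ^ n" for n
  proof -
    have "(- z) ^ n = (-1) ^ n * z ^ n" by (rule power_minus)
    moreover have "(-1::complex) ^ n * (-1) ^ n = 1" by (simp flip: power_mult_distrib)
    ultimately show ?thesis by (simp add: gbinomial_pochhammer)
  qed
  ultimately show ?thesis by simp
qed

lemma pochhammer_pos_real_ne_0: "c > 0 \<Longrightarrow> pochhammer (complex_of_real c) n \<noteq> 0"
  using pochhammer_pos[of c n] by (simp add: pochhammer_of_real)

text \<open>
  Euler's integral is read as the expectation of \<open>(1 - z * t) powr (- a)\<close> under the Beta
  distribution with parameters \<open>b\<close> and \<open>c - b\<close>. The \<open>n\<close>-th moment of that distribution is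
  \<open>pochhammer b n / pochhammer c n\<close>, which is the factor by which the hypergeometric series differs
  from the binomial series.
\<close>
lemma euler_integral_hyp2F1:
  fixes b c :: real and a :: complex
  assumes b: "b > 0" and c: "b < c"
  shows "\<exists>f. f holomorphic_on cut_plane \<and>
     (\<forall>u\<in>ball 0 1. hyp2F1_term a (of_real b) (of_real c) u sums f u)"
proof -
  define w where "w = (\<lambda>t::real. t powr (b - 1) * (1 - t) powr (c - b - 1) / Beta b (c - b))"
  have B_pos: "Beta b (c - b) > 0" using b c by (simp add: Beta_def Gamma_real_pos)
  have w_nonneg: "w t \<ge> 0" for t using B_pos by (simp add: w_def)
  define L where "L = restrict_space lborel {0..1::real}"
  define N where "N = density L (\<lambda>t. ennreal (w t))"
  have sets_N: "sets N = sets (restrict_space borel {0..1})"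
    by (simp add: N_def L_def cong: sets_restrict_space_cong)
  have w_meas[measurable]: "w \<in> borel_measurable borel" by (simp add: w_def)
  have w_measL: "w \<in> borel_measurable L"
    unfolding L_def by (rule measurable_restrict_space1) simp
  have moment: "has_bochner_integral N (\<lambda>t. t ^ n) (pochhammer b n / pochhammer c n)" for n
  proof -
    have "((\<lambda>t. t powr (b + real n - 1) * (1 - t) powr (c - b - 1)) has_integral Beta (b + n) (c - b)) {0..1}"
      using has_integral_Beta_real[of "b + n" "c - b"] b c by simp
    then have "((\<lambda>t. (t powr (b + real n - 1) * (1 - t) powr (c - b - 1)) / Beta b (c - b)) has_integral
        (Beta (b + n) (c - b)) / Beta b (c - b)) {0..1}"
      by (rule has_integral_divide)
    also have "?this \<longleftrightarrow> ((\<lambda>t. w t * t ^ n) has_integral (Beta (b + n) (c - b)) / Beta b (c - b)) {0..1}"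
    proof (rule has_integral_spike_eq)
      \<comment> \<open>The point 0 is excluded because \<open>0 powr 0 = 0\<close>, whereas \<open>0 ^ 0 = 1\<close>.\<close>
      show "negligible {0::real}" by simp
      show "w t * t ^ n = t powr (b + real n - 1) * (1 - t) powr (c - b - 1) / Beta b (c - b)"
        if "t \<in> {0..1} - {0}" for t
        using that by (simp add: w_def powr_add[symmetric] powr_realpow[symmetric] algebra_simps)
    qed
    also have "Beta (b + n) (c - b) / Beta b (c - b) = pochhammer b n / pochhammer c n"
    proof -
      have "b \<notin> \<int>\<^sub>\<le>\<^sub>0" "c \<notin> \<int>\<^sub>\<le>\<^sub>0" using b c by (auto elim!: nonpos_Ints_cases)
      moreover have "Gamma b \<noteq> 0" "Gamma c \<noteq> 0" "Gamma (c - b) \<noteq> 0" "Gamma (c + real n) \<noteq> 0"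
        using b c by (auto intro!: less_imp_neq[THEN not_sym] Gamma_real_pos)
      ultimately show ?thesis by (simp add: Beta_def pochhammer_Gamma add_ac)
    qed
    finally have hi: "((\<lambda>t. w t * t ^ n) has_integral (pochhammer b n / pochhammer c n)) {0..1}" .
    have "has_bochner_integral lborel (\<lambda>t. indicator {0..1} t *\<^sub>R (w t * t ^ n)) (pochhammer b n / pochhammer c n)"
    proof -
      have "(\<lambda>t. w t * t ^ n) absolutely_integrable_on {0..1}"
        using hi w_nonneg by (intro nonnegative_absolutely_integrable_1) auto
      then have "set_integrable lborel {0..1} (\<lambda>t. w t * t ^ n)"
        unfolding set_integrable_def 
        by (subst integrable_completion[symmetric]) auto
      then show ?thesis
        using set_borel_integral_eq_integral[of "{0..1}" "\<lambda>t. w t * t ^ n"] hi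
        by (auto simp: has_bochner_integral_iff set_integrable_def set_lebesgue_integral_def
              dest: integral_unique)
    qed
    then have "has_bochner_integral L (\<lambda>t. w t *\<^sub>R t ^ n) (pochhammer b n / pochhammer c n)"
      by (simp add: L_def has_bochner_integral_restrict_space)
    then show ?thesis
      unfolding N_def
      by (intro has_bochner_integral_density) (auto simp: w_nonneg w_measL L_def intro: measurable_restrict_space1)
  qed
  have fin: "finite_measure N"
    using moment[of 0] by (auto simp: has_bochner_integral_iff intro!: finite_measureI)
  interpret finite_measure N by fact
  have space_N: "space N = {0..1}" by (simp add: N_def L_def space_restrict_space)
  define f where "f = (\<lambda>z. \<integral>t. (1 - z * of_real t) powr (- a) \<partial>N)"
  have "f holomorphic_on cut_plane"
    unfolding f_def
  proof (rule holomorphic_on_parameter_integral[OF fin sets_N open_cut_plane,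
          where h' = "\<lambda>z t. a * of_real t * (1 - z * of_real t) powr (- a - 1)"])
    fix z :: complex and t :: real assume "z \<in> cut_plane" "t \<in> {0..1}"
    then have "1 - z * of_real t \<notin> \<real>\<^sub>\<le>\<^sub>0" using scaled_cut_plane_avoids_nonpos by auto
    then show "((\<lambda>z. (1 - z * of_real t) powr - a) has_field_derivative
        a * of_real t * (1 - z * of_real t) powr (- a - 1)) (at z)"
      by (auto intro!: derivative_eq_intros simp: algebra_simps)
  next
    fix z :: complex assume "z \<in> cut_plane"
    then show "continuous_on {0..1} (\<lambda>t. (1 - z * complex_of_real t) powr - a)"
      using scaled_cut_plane_avoids_nonpos by (intro continuous_on_powr_const continuous_intros) auto
  next
    show "continuous_on (cut_plane \<times> {0..1}) (\<lambda>(z, t). a * complex_of_real t * (1 - z * complex_of_real t) powr (- a - 1))"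
      using scaled_cut_plane_avoids_nonpos unfolding case_prod_unfold
      by (intro continuous_on_powr_const continuous_intros) auto
  qed
  moreover have "hyp2F1_term a (of_real b) (of_real c) u sums f u" if u: "u \<in> ball 0 1" for u
  proof -
    have u1: "norm u < 1" using u by simp
    define g where "g = (\<lambda>n t. pochhammer a n / fact n * (u * complex_of_real t) ^ n)"
    have norm_sum: "summable (\<lambda>n. norm (pochhammer a n / fact n * u ^ n))"
    proof -
      obtain r where r: "norm u < r" "r < 1" using dense[OF u1] by auto
      have "norm (complex_of_real r) < 1" using r le_less_trans[OF norm_ge_zero[of u] r(1)] by simp
      from powser_insidea[OF sums_summable[OF binomial_series_complex[OF this]], of u]
      show ?thesis using r le_less_trans[OF norm_ge_zero[of u] r(1)] by simp
    qed
    have int: "integrable N (g n)" for n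
    proof -
      have "integrable N (\<lambda>t. complex_of_real (t ^ n))"
        using moment[of n] by (intro integrable_of_real) (simp add: has_bochner_integral_iff)
      then show ?thesis by (simp add: g_def power_mult_distrib)
    qed
    have "(\<lambda>n. integral\<^sup>L N (g n)) sums (\<integral>t. (\<Sum>n. g n t) \<partial>N)"
    proof (rule sums_integral[OF int])
      have bound: "norm (g n t) \<le> norm (pochhammer a n / fact n * u ^ n)" if "t \<in> space N" for n t
      proof -
        have "\<bar>t\<bar> ^ n \<le> 1" using that by (intro power_le_one) (auto simp: space_N)
        then show ?thesis
          by (simp add: g_def norm_mult norm_divide norm_power power_mult_distrib mult_left_le
                divide_right_mono mult_left_mono)
      qed
      show "AE t in N. summable (\<lambda>n. norm (g n t))"
        by (intro AE_I2 summable_comparison_test'[OF norm_sum, of 0]) (use bound in auto)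
      show "summable (\<lambda>n. \<integral>t. norm (g n t) \<partial>N)"
      proof (rule summable_comparison_test'[OF summable_mult[OF norm_sum, of "measure N (space N)"], of 0])
        fix n
        have "(\<integral>t. norm (g n t) \<partial>N) \<le> (\<integral>t. norm (pochhammer a n / fact n * u ^ n) \<partial>N)"
          by (intro integral_mono_AE integrable_norm int AE_I2 bound) auto
        then show "norm (\<integral>t. norm (g n t) \<partial>N) \<le> measure N (space N) * norm (pochhammer a n / fact n * u ^ n)"
          by simp
      qed
    qed
    also have "(\<lambda>n. integral\<^sup>L N (g n)) = hyp2F1_term a (of_real b) (of_real c) u"
    proof
      fix n
      have "integral\<^sup>L N (g n) = pochhammer a n / fact n * u ^ n * (\<integral>t. complex_of_real (t ^ n) \<partial>N)"
        by (simp add: g_def power_mult_distrib mult.assoc[symmetric])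
      also have "(\<integral>t. complex_of_real (t ^ n) \<partial>N) = of_real (pochhammer b n / pochhammer c n)"
        using moment[of n] by (simp only: integral_complex_of_real has_bochner_integral_iff)
      finally show "integral\<^sup>L N (g n) = hyp2F1_term a (of_real b) (of_real c) u n"
        by (simp add: hyp2F1_term_def pochhammer_of_real[symmetric] mult_ac)
    qed
    also have "(\<integral>t. (\<Sum>n. g n t) \<partial>N) = f u"
      unfolding f_def
    proof (rule Bochner_Integration.integral_cong[OF refl])
      fix t assume "t \<in> space N"
      then have "norm (u * complex_of_real t) \<le> norm u"
        by (simp add: space_N norm_mult mult_left_le)
      then have "norm (u * complex_of_real t) < 1" using u1 by simp
      from binomial_series_complex[OF this, of a] show "(\<Sum>n. g n t) = (1 - u * of_real t) powr - a"
        by (simp add: g_def sums_iff)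
    qed
    finally show ?thesis .
  qed
  ultimately show ?thesis by blast
qed

text \<open>
  On the coefficients, \<open>f \<mapsto> f + z * f' / c\<close> is multiplication by \<open>(c + n) / c\<close>, and
  \<open>pochhammer (c + 1) n = pochhammer c n * (c + n) / c\<close>. This removes the restriction
  \<open>c > b\<close> of Euler's integral.
\<close>
lemma hyp2F1_continuation_decrease_c:
  fixes a b c :: complex
  assumes c: "\<And>n. pochhammer c n \<noteq> 0"
    and "f holomorphic_on cut_plane"
    and sums: "\<And>u. u \<in> ball 0 1 \<Longrightarrow> hyp2F1_term a b (c + 1) u sums f u"
  shows "(\<lambda>z. f z + z * deriv f z / c) holomorphic_on cut_plane"
    and "\<And>u. u \<in> ball 0 1 \<Longrightarrow> hyp2F1_term a b c u sums (f u + u * deriv f u / c)"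
proof -
  have c0: "c \<noteq> 0" using c[of 1] by simp
  have poch: "pochhammer (c + 1) n = pochhammer c n * (c + of_nat n) / c" for n
    using c0 pochhammer_rec[of c n] pochhammer_Suc[of c n] by (simp add: eq_divide_eq mult_ac)
  have cn: "c + of_nat n \<noteq> 0" for n using c[of "Suc n"] by (simp add: pochhammer_Suc)
  show "(\<lambda>z. f z + z * deriv f z / c) holomorphic_on cut_plane"
    using assms c0 by (intro holomorphic_intros holomorphic_deriv open_cut_plane) auto
  fix u :: complex assume u: "u \<in> ball 0 1"
  define d where "d = (\<lambda>n. pochhammer a n * pochhammer b n / pochhammer (c + 1) n / fact n)"
  have term_eq: "hyp2F1_term a b (c + 1) v n = d n * v ^ n" for v n
    by (simp add: hyp2F1_term_def d_def)
  have "u \<in> cut_plane" using u abs_Re_le_cmod[of u] by (auto simp: mem_cut_plane_iff)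
  then have df: "(f has_field_derivative deriv f u) (at u)"
    using assms(2) by (intro holomorphic_derivI[OF _ open_cut_plane])
  have "(\<lambda>n. diffs d n * u ^ n) sums deriv f u"
    by (rule termdiffs_sums_strong[OF _ df, of 1]) (use sums u in \<open>auto simp: term_eq[abs_def]\<close>)
  then have "(\<lambda>n. u * (diffs d n * u ^ n)) sums (u * deriv f u)" by (rule sums_mult)
  then have "(\<lambda>n. of_nat (Suc n) * d (Suc n) * u ^ Suc n) sums (u * deriv f u)"
    by (simp add: diffs_def mult_ac)
  then have "(\<lambda>n. of_nat n * d n * u ^ n) sums (u * deriv f u)"
    by (subst (asm) sums_Suc_iff) simp
  from sums_add[OF sums[OF u] sums_divide[OF this, of c]]
  have "(\<lambda>n. d n * u ^ n + of_nat n * d n * u ^ n / c) sums (f u + u * deriv f u / c)"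
    by (simp add: term_eq[abs_def])
  moreover have "d n * u ^ n + of_nat n * d n * u ^ n / c = hyp2F1_term a b c u n" for n
  proof -
    have "d n * u ^ n + of_nat n * d n * u ^ n / c = d n * (c + of_nat n) / c * u ^ n"
      using c0 by (simp add: field_simps)
    also have "d n * (c + of_nat n) / c = pochhammer a n * pochhammer b n / pochhammer c n / fact n"
    proof -
      have "y / (P * X / c) / F * X / c = y / P / F" if "X \<noteq> 0" for y P X F :: complex
        using c0 that by (cases "P = 0") (simp_all add: divide_simps)
      from this[OF cn[of n]] show ?thesis unfolding d_def poch .
    qed
    finally show ?thesis by (simp add: hyp2F1_term_def)
  qed
  ultimately show "hyp2F1_term a b c u sums (f u + u * deriv f u / c)" by simp
qed

theorem hyp2F1_analytic_continuation:
  fixes a :: complex and b c :: real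
  assumes b: "b > 0" and c: "c > 0"
  obtains f where "f holomorphic_on cut_plane"
    "\<And>u. u \<in> ball 0 1 \<Longrightarrow> hyp2F1_term a (of_real b) (of_real c) u sums f u"
proof -
  \<comment> \<open>Induction on the number \<open>N\<close> of unit steps by which \<open>c\<close> has to be raised to exceed \<open>b\<close>.\<close>
  have *: "\<exists>f. f holomorphic_on cut_plane \<and>
     (\<forall>u\<in>ball 0 1. hyp2F1_term a (of_real b) (of_real c) u sums f u)"
    if "c > 0" "b < c + real N" for c N
    using that
  proof (induction N arbitrary: c)
    case 0
    then show ?case using euler_integral_hyp2F1[OF b] by simp
  next
    case (Suc N)
    then obtain f where f: "f holomorphic_on cut_plane"
       "\<And>u. u \<in> ball 0 1 \<Longrightarrow> hyp2F1_term a (of_real b) (of_real c + 1) u sums f u"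
      using Suc.IH[of "c + 1"] by (auto simp: add_ac)
    show ?case
      using hyp2F1_continuation_decrease_c[OF pochhammer_pos_real_ne_0[OF \<open>c > 0\<close>] f] by blast
  qed
  obtain N :: nat where "b < real N" using reals_Archimedean2 by blast
  with *[OF c, of N] c show ?thesis using that by auto
qed

text \<open>
  The cut plane is star-shaped about 0.
\<close>
lemma cut_plane_scale:
  assumes "z \<in> cut_plane" "0 \<le> u" "u \<le> 1"
  shows "complex_of_real u * z \<in> cut_plane"
proof -
  have "u * Re z < 1" if "Re z < 1"
  proof (cases "Re z \<le> 0")
    case True
    then show ?thesis using assms mult_nonneg_nonpos[of u "Re z"] by simp
  next
    case False
    then have "u * Re z \<le> Re z" using assms by (intro mult_left_le_one_le) auto
    then show ?thesis using that by simp
  qed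
  then show ?thesis using assms by (cases "u = 0") (auto simp: mem_cut_plane_iff)
qed

lemma ball_subset_cut_plane: "ball 0 1 \<subseteq> cut_plane"
proof
  fix z :: complex assume "z \<in> ball 0 1"
  then show "z \<in> cut_plane" using abs_Re_le_cmod[of z] by (auto simp: mem_cut_plane_iff)
qed

lemma connected_cut_plane_Int:
  assumes "convex B" "0 \<in> B"
  shows "connected (cut_plane \<inter> B)"
proof (rule starlike_imp_connected)
  have "closed_segment 0 z \<subseteq> cut_plane \<inter> B" if "z \<in> cut_plane \<inter> B" for z
  proof -
    have "closed_segment 0 z \<subseteq> B" using assms that by (intro closed_segment_subset) auto
    moreover have "closed_segment 0 z \<subseteq> cut_plane"
      using that cut_plane_scale by (auto simp: closed_segment_def scaleR_conv_of_real)
    ultimately show ?thesis by blast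
  qed
  then show "starlike (cut_plane \<inter> B)"
    using assms ball_subset_cut_plane unfolding starlike_def by (intro bexI[of _ 0]) auto
qed

lemma connected_cut_plane: "connected cut_plane"
  using connected_cut_plane_Int[of UNIV] by simp

section \<open>Values of the hypergeometric function off the cut\<close>

text \<open>
  Abel's limit theorem along a radius. With partial sums \<open>P n\<close>, the Cauchy product with the
  geometric series gives \<open>(\<Sum>n. c n * r ^ n) - s = (1 - r) * (\<Sum>n. (P n - s) * r ^ n)\<close>; the finitely many terms in which
  \<open>P n\<close> is not yet close to \<open>s\<close> are made small by the factor \<open>1 - r\<close>.
\<close>
lemma Abel_limit_at_left:
  fixes c :: "nat \<Rightarrow> complex"
  assumes "c sums s"
  shows "((\<lambda>r. \<Sum>n. c n * of_real r ^ n) \<longlongrightarrow> s) (at_left 1)"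
proof -
  define P where "P = (\<lambda>n. \<Sum>i\<le>n. c i)"
  have P: "P \<longlonglongrightarrow> s"
    using assms unfolding sums_def_le P_def .
  define F where "F = (\<lambda>r::real. \<Sum>n. c n * of_real r ^ n)"
  have key: "(\<lambda>k. (P k - s) * of_real r ^ k) sums ((F r - s) / (1 - of_real r))"
    if r: "0 < r" "r < 1" for r
  proof -
    have x: "norm (complex_of_real r) < 1" using r by simp
    have "summable (\<lambda>n. c n * 1 ^ n)" using assms by (simp add: sums_iff)
    then have c: "summable (\<lambda>n. norm (c n * of_real r ^ n))"
      by (rule powser_insidea) (use r in simp)
    have "(\<lambda>k. \<Sum>i\<le>k. (c i * of_real r ^ i) * of_real r ^ (k - i)) sums
       ((\<Sum>n. c n * of_real r ^ n) * (\<Sum>n. of_real r ^ n))"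
      by (rule Cauchy_product_sums[OF c]) (use r in \<open>simp add: norm_power summable_geometric\<close>)
    also have "(\<lambda>k. \<Sum>i\<le>k. (c i * of_real r ^ i) * of_real r ^ (k - i)) = (\<lambda>k. P k * of_real r ^ k)"
      by (simp add: P_def sum_distrib_right mult.assoc power_add[symmetric])
    also have "(\<Sum>n. of_real r ^ n) = 1 / (1 - complex_of_real r)" by (rule suminf_geometric[OF x])
    finally have "(\<lambda>k. P k * of_real r ^ k) sums (F r / (1 - of_real r))" by (simp add: F_def)
    from sums_diff[OF this sums_mult[OF geometric_sums[OF x], of s]]
    show ?thesis by (simp add: algebra_simps diff_divide_distrib)
  qed
  show ?thesis
    unfolding F_def[symmetric] tendsto_iff
  proof (intro allI impI)
    fix e :: real assume e: "e > 0"
    from P e obtain N where N: "\<And>k. k \<ge> N \<Longrightarrow> norm (P k - s) < e / 2"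
      using LIMSEQ_D[OF P, of "e / 2"] by auto
    define B where "B = (\<Sum>k<N. norm (P k - s))"
    have B: "B \<ge> 0" by (simp add: B_def sum_nonneg)
    have le: "norm (F r - s) \<le> (1 - r) * B + e / 2" if r: "0 < r" "r < 1" for r
    proof -
      define g where "g = (\<lambda>k. (if k \<in> {..<N} then norm (P k - s) else 0) + e / 2 * r ^ k)"
      have "(\<lambda>k. e / 2 * r ^ k) sums (e / 2 * (1 / (1 - r)))"
        using r by (intro sums_mult geometric_sums) auto
      then have g: "g sums (B + e / 2 * (1 / (1 - r)))"
        unfolding g_def B_def by (intro sums_add sums_If_finite_set) auto
      have "norm (\<Sum>k. (P k - s) * of_real r ^ k) \<le> (\<Sum>k. g k)"
      proof (rule norm_suminf_le)
        fix k
        show "norm ((P k - s) * of_real r ^ k) \<le> g k"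
        proof (cases "k < N")
          case True
          have "norm (P k - s) * r ^ k \<le> norm (P k - s)"
            using r by (intro mult_left_le power_le_one) auto
          moreover have "e / 2 * r ^ k \<ge> 0" using e r by simp
          ultimately show ?thesis using True r by (simp add: g_def norm_mult norm_power)
        next
          case False
          then have "norm (P k - s) * r ^ k \<le> e / 2 * r ^ k"
            using N[of k] r by (intro mult_right_mono) auto
          then show ?thesis using False r by (simp add: g_def norm_mult norm_power)
        qed
      qed (use g in \<open>simp add: sums_iff\<close>)
      then have "norm ((F r - s) / (1 - of_real r)) \<le> B + e / 2 * (1 / (1 - r))"
        using key[OF r] g by (simp add: sums_iff)
      moreover have "norm ((F r - s) / (1 - of_real r)) = norm (F r - s) / (1 - r)"
      proof -
        have "norm (1 - complex_of_real r) = 1 - r"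
          using r by (metis abs_of_pos diff_gt_0_iff_gt norm_of_real of_real_1 of_real_diff)
        then show ?thesis by (simp add: norm_divide)
      qed
      ultimately have "norm (F r - s) / (1 - r) \<le> B + e / 2 / (1 - r)" by simp
      also have "\<dots> = ((1 - r) * B + e / 2) / (1 - r)" using r by (simp add: add_divide_distrib)
      finally show ?thesis using r by (simp add: divide_le_cancel)
    qed
    \<comment> \<open>Chosen so that \<open>(1 - r) * (B + 1) < e / 2\<close> for \<open>r > r0\<close>.\<close>
    define r0 where "r0 = max 0 (1 - e / (2 * (B + 1)))"
    have "r0 < 1" using e B by (simp add: r0_def)
    then have "eventually (\<lambda>r. r \<in> {r0<..<1}) (at_left 1)"
      by (rule eventually_at_left_real)
    then show "eventually (\<lambda>r. dist (F r) s < e) (at_left 1)"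
    proof eventually_elim
      case (elim r)
      then have r: "0 < r" "r < 1" "1 - r < e / (2 * (B + 1))" by (auto simp: r0_def)
      have "(1 - r) * B \<le> (1 - r) * (B + 1)" using r by simp
      also have "\<dots> < e / 2" using r(3) B by (simp add: field_simps)
      finally show ?case using le[OF r(1,2)] by (simp add: dist_norm)
    qed
  qed
qed

text \<open>
  Every holomorphic extension of the series to the cut plane represents the function. If the
  series diverges at \<open>z\<close>, this is uniqueness of the continuation. If it converges at a point \<open>z\<close> outside
  the open unit disc, it converges in the open disc of radius \<open>norm z\<close> and agrees there with \<open>f\<close> off the
  cut; Abel's theorem carries the equality to \<open>z\<close> on the boundary.
\<close>
theorem hyp2F1_eq_continuation:
  assumes f: "f holomorphic_on cut_plane"
    and sums: "\<And>u. u \<in> ball 0 1 \<Longrightarrow> hyp2F1_term a b c u sums f u"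
    and z: "z \<in> cut_plane"
  shows "hyp2F1 a b c z = f z"
proof (cases "summable (hyp2F1_term a b c z)")
  case False
  have "(THE w. \<exists>f. f holomorphic_on (- complex_of_real ` {1..}) \<and>
          (\<forall>u\<in>ball 0 1. hyp2F1_term a b c u sums f u) \<and> f z = w) = f z"
  proof (rule the_equality)
    fix w assume "\<exists>f. f holomorphic_on (- complex_of_real ` {1..}) \<and>
          (\<forall>u\<in>ball 0 1. hyp2F1_term a b c u sums f u) \<and> f z = w"
    then obtain g where g: "g holomorphic_on cut_plane"
        "\<And>u. u \<in> ball 0 1 \<Longrightarrow> hyp2F1_term a b c u sums g u" "g z = w"
      by (auto simp: cut_plane_def)
    have "g z = f z"
    proof (rule analytic_continuation_open[of "ball 0 1" cut_plane g f])
      show "g u = f u" if "u \<in> ball 0 1" for u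
        using g(2)[OF that] sums[OF that] by (rule sums_unique2)
    qed (use g f z ball_subset_cut_plane open_cut_plane connected_cut_plane in auto)
    then show "w = f z" using g by simp
  qed (use f sums in \<open>auto simp: cut_plane_def\<close>)
  then show ?thesis using False by (simp add: hyp2F1_def)
next
  case True
  show ?thesis
  proof (cases "norm z < 1")
    case True
    then show ?thesis using sums[of z] \<open>summable _\<close> by (simp add: hyp2F1_def sums_iff)
  next
    case False
    define d where "d = (\<lambda>n. pochhammer a n * pochhammer b n / pochhammer c n / fact n)"
    have term_eq: "hyp2F1_term a b c v = (\<lambda>n. d n * v ^ n)" for v
      by (simp add: hyp2F1_term_def d_def fun_eq_iff)
    define R where "R = norm z"
    have R: "R \<ge> 1" using False by (simp add: R_def)
    define s where "s = (\<lambda>w. \<Sum>n. d n * w ^ n)"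
    have s_sums: "(\<lambda>n. d n * w ^ n) sums s w" if "norm w < R" for w
      using powser_inside[of d z w] True that by (simp add: term_eq s_def R_def summable_sums)
    have s_holo: "s holomorphic_on ball 0 R"
      by (rule power_series_holomorphic) (use s_sums in auto)
    have s_eq: "s w = f w" if w: "w \<in> cut_plane \<inter> ball 0 R" for w
    proof (rule analytic_continuation_open[of "ball 0 1" "cut_plane \<inter> ball 0 R" s f])
      show "connected (cut_plane \<inter> ball 0 R)"
        using R by (intro connected_cut_plane_Int) auto
      show "ball 0 1 \<subseteq> cut_plane \<inter> ball 0 R"
        using R ball_subset_cut_plane by auto
      show "s u = f u" if "u \<in> ball 0 1" for u
        using sums[OF that] s_sums[of u] that R unfolding term_eq by (auto intro: sums_unique2)
    qed (use w f s_holo open_cut_plane in \<open>auto intro: holomorphic_on_subset\<close>)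
    have "((\<lambda>r. \<Sum>n. d n * z ^ n * of_real r ^ n) \<longlongrightarrow> (\<Sum>n. d n * z ^ n)) (at_left 1)"
      using True by (intro Abel_limit_at_left) (simp add: term_eq summable_sums)
    also have "?this \<longleftrightarrow> ((\<lambda>r. f (of_real r * z)) \<longlongrightarrow> (\<Sum>n. d n * z ^ n)) (at_left 1)"
    proof (rule tendsto_cong)
      have "eventually (\<lambda>r::real. r \<in> {0<..<1}) (at_left 1)"
        by (rule eventually_at_left_real) simp
      then show "eventually (\<lambda>r. (\<Sum>n. d n * z ^ n * of_real r ^ n) = f (of_real r * z)) (at_left 1)"
      proof eventually_elim
        case (elim r)
        have "of_real r * z \<in> cut_plane \<inter> ball 0 R"
        proof -
          have "r * R < 1 * R" using elim R by (intro mult_strict_right_mono) auto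
          then show ?thesis using elim cut_plane_scale[OF z, of r] by (auto simp: norm_mult R_def)
        qed
        from s_eq[OF this] show ?case by (simp add: s_def power_mult_distrib mult_ac)
      qed
    qed
    finally have 1: "((\<lambda>r. f (of_real r * z)) \<longlongrightarrow> (\<Sum>n. d n * z ^ n)) (at_left 1)" .
    have "isCont f (of_real 1 * z)"
      using holomorphic_on_imp_continuous_on[OF f] z
      by (simp add: continuous_on_eq_continuous_at[OF open_cut_plane])
    then have 2: "((\<lambda>r. f (of_real r * z)) \<longlongrightarrow> f (of_real 1 * z)) (at_left 1)"
      by (rule isCont_tendsto_compose) (intro tendsto_intros)
    from tendsto_unique[OF _ 1 2] show ?thesis
      using True by (simp add: hyp2F1_def term_eq)
  qed
qed

section \<open>Pfaff's transformation\<close>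

lemma pochhammer_neg_of_nat:
  assumes "i \<le> n"
  shows "pochhammer (- of_nat n :: 'a::field_char_0) i = (-1) ^ i * fact n / fact (n - i)"
proof -
  have "of_nat (n choose i) = ((-1) ^ i * pochhammer (- of_nat n :: 'a) i / fact i)"
    by (simp add: binomial_gbinomial gbinomial_pochhammer)
  moreover have "of_nat (n choose i) = (fact n / (fact i * fact (n - i)) :: 'a)"
    by (rule binomial_fact[OF assms])
  ultimately have "(-1) ^ i * pochhammer (- of_nat n :: 'a) i = fact n / fact (n - i)"
    by (simp add: field_simps)
  then have "(-1) ^ i * ((-1) ^ i * pochhammer (- of_nat n :: 'a) i) = (-1) ^ i * fact n / fact (n - i)"
    by simp
  moreover have "(-1::'a) ^ i * (-1) ^ i = 1" by (simp flip: power_mult_distrib)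
  ultimately show ?thesis by (simp add: mult.assoc[symmetric])
qed

lemma hyp2F1_term_of_real:
  "hyp2F1_term (of_real a) (of_real b) (of_real c) (of_real x) n =
     of_real (pochhammer a n * pochhammer b n / pochhammer c n / fact n * x ^ n)"
  by (simp add: hyp2F1_term_def pochhammer_of_real)

text \<open>
  The Chu--Vandermonde identity in the form in which it occurs when the right-hand side of Pfaff's
  transformation is expanded in powers of \<open>z\<close>.
\<close>
lemma pfaff_coefficient:
  fixes b c e :: real
  assumes c: "c > 0"
  shows "(\<Sum>i\<le>n. (-1) ^ i * (pochhammer e i * pochhammer b i / pochhammer c i / fact i) *
            (pochhammer (b + real i) (n - i) / fact (n - i))) =
         pochhammer (c - e) n * pochhammer b n / pochhammer c n / fact n"
proof -
  have "(-1) ^ i * (pochhammer e i * pochhammer b i / pochhammer c i / fact i) *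
            (pochhammer (b + real i) (n - i) / fact (n - i)) =
        pochhammer b n / fact n * (pochhammer e i * pochhammer (- real n) i / (fact i * pochhammer c i))"
    if "i \<le> n" for i
    using pochhammer_product[OF that, of b] pochhammer_neg_of_nat[OF that, where 'a = real]
    by (simp add: mult_ac)
  then have "(\<Sum>i\<le>n. (-1) ^ i * (pochhammer e i * pochhammer b i / pochhammer c i / fact i) *
            (pochhammer (b + real i) (n - i) / fact (n - i))) =
     pochhammer b n / fact n * (\<Sum>i=0..n. pochhammer e i * pochhammer (- real n) i / (fact i * pochhammer c i))"
    by (simp add: sum_distrib_left atMost_atLeast0)
  also have "(\<Sum>i=0..n. pochhammer e i * pochhammer (- real n) i / (fact i * pochhammer c i)) =
      pochhammer (c - e) n / pochhammer c n"
    using Vandermonde_pochhammer[of n c e] c by auto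
  finally show ?thesis by (simp add: mult_ac)
qed

text \<open>
  Expanding \<open>(1 - z) powr (- b - i)\<close> in the \<open>i\<close>-th term of the right-hand side gives a double series,
  which is summed in rows and along antidiagonals. As \<open>b\<close>, \<open>c\<close> and \<open>e\<close> are positive, the sum of the
  norms is the same double series at \<open>\<bar>z\<bar>\<close> with all signs positive; it converges when
  \<open>\<bar>z\<bar> / (1 - \<bar>z\<bar>) < 1\<close>, that is for \<open>\<bar>z\<bar> < 1 / 2\<close>.
\<close>
lemma pfaff_transformation_near_0:
  fixes b c e :: real
  assumes b: "b > 0" and c: "c > 0" and e: "e > 0" and z: "norm z < 1 / 2"
    and S: "hyp2F1_term (of_real e) (of_real b) (of_real c) (z / (z - 1)) sums S"
  shows "hyp2F1_term (of_real (c - e)) (of_real b) (of_real c) z sums ((1 - z) powr (- of_real b) * S)"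
proof -
  define h where "h = (\<lambda>i. pochhammer e i * pochhammer b i / pochhammer c i / fact i)"
  define p where "p = (\<lambda>i j. pochhammer (b + real i) j / fact j)"
  define x where "x = norm z"
  have x: "0 \<le> x" "x < 1 / 2" using z by (auto simp: x_def)
  have h_nonneg: "h i \<ge> 0" for i
    using b c e by (simp add: h_def pochhammer_nonneg)
  have p_nonneg: "p i j \<ge> 0" for i j using b by (simp add: p_def pochhammer_nonneg)
  have h_summable: "summable (\<lambda>i. h i * y ^ i)" if "0 \<le> y" "y < 1" for y
  proof -
    obtain f where "\<And>u. u \<in> ball 0 1 \<Longrightarrow> hyp2F1_term (of_real e) (of_real b) (of_real c) u sums f u"
      using hyp2F1_analytic_continuation[OF b c] by metis
    from this[of "of_real y"] that have "summable (\<lambda>i. complex_of_real (h i * y ^ i))"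
      unfolding hyp2F1_term_of_real h_def by (simp add: sums_iff)
    then show ?thesis by (rule summable_of_real_iff[THEN iffD1])
  qed
  have binom: "(\<lambda>j. of_real (p i j) * w ^ j) sums ((1 - w) powr (- of_real b) / (1 - w) ^ i)"
    if "norm w < 1" for w :: complex and i
  proof -
    have "w \<noteq> 1" using that by auto
    have "(1 - w) powr (- of_real (b + real i)) = (1 - w) powr (- of_real b) / (1 - w) powr of_nat i"
      by (simp add: powr_diff[symmetric])
    also have "(1 - w) powr of_nat i = (1 - w) ^ i" using \<open>w \<noteq> 1\<close> by (simp add: powr_nat)
    finally show ?thesis
      using binomial_series_complex[OF that, of "of_real (b + real i)"]
      by (simp only: p_def of_real_divide of_real_fact pochhammer_of_real)
  qed
  have binom_real: "(\<lambda>j. p i j * x ^ j) sums ((1 - x) powr (- b) / (1 - x) ^ i)" for i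
  proof -
    have "(\<lambda>j. complex_of_real (p i j * x ^ j)) sums of_real ((1 - x) powr (- b) / (1 - x) ^ i)"
      using binom[of "of_real x" i] x by (simp add: powr_of_real[symmetric])
    then show ?thesis by (simp only: sums_of_real_iff)
  qed
  define T :: "nat \<times> nat \<Rightarrow> complex" where
    "T = (\<lambda>(i,j). of_real (h i) * (- z) ^ i * (of_real (p i j) * z ^ j))"
  have "(\<lambda>ij. norm (T ij)) summable_on (UNIV \<times> UNIV)"
  proof (rule summable_on_SigmaI)
    fix i :: nat
    have "(\<lambda>j. h i * x ^ i * (p i j * x ^ j)) sums (h i * x ^ i * ((1 - x) powr (- b) / (1 - x) ^ i))"
      by (intro sums_mult binom_real)
    then have "((\<lambda>j. h i * x ^ i * (p i j * x ^ j)) has_sum (h i * x ^ i * ((1 - x) powr (- b) / (1 - x) ^ i))) UNIV"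
      by (rule sums_nonneg_imp_has_sum) (simp add: h_nonneg p_nonneg x)
    then show "((\<lambda>j. norm (T (i, j))) has_sum (h i * x ^ i * ((1 - x) powr (- b) / (1 - x) ^ i))) UNIV"
      by (simp add: T_def norm_mult norm_power x_def h_nonneg p_nonneg)
  next
    have "summable (\<lambda>i. (1 - x) powr (- b) * (h i * (x / (1 - x)) ^ i))"
      using x by (intro summable_mult h_summable) (auto simp: field_simps)
    then have "summable (\<lambda>i. h i * x ^ i * ((1 - x) powr (- b) / (1 - x) ^ i))"
      by (simp add: power_divide mult_ac)
    then show "(\<lambda>i. h i * x ^ i * ((1 - x) powr (- b) / (1 - x) ^ i)) summable_on UNIV"
      by (subst summable_on_UNIV_nonneg_real_iff) (use x h_nonneg in auto)
  qed auto
  then have "(\<lambda>ij. norm (T ij)) summable_on UNIV" by simp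
  then have "T summable_on UNIV" by (rule abs_summable_summable)
  then obtain X where X: "(T has_sum X) (UNIV \<times> UNIV)" by (auto simp: summable_on_def)
  define r where "r = (\<lambda>i. of_real (h i) * (- z) ^ i * ((1 - z) powr (- of_real b) / (1 - z) ^ i))"
  have "((\<lambda>i. r i) has_sum X) UNIV"
  proof (rule has_sum_SigmaD[OF X])
    fix i :: nat
    have "(\<lambda>j. T (i, j)) summable_on UNIV"
      using summable_on_SigmaD1[of "\<lambda>i j. T (i, j)" UNIV "\<lambda>_. UNIV" i] X
      by (auto simp: summable_on_def case_prod_unfold)
    then obtain y where y: "((\<lambda>j. T (i, j)) has_sum y) UNIV" by (auto simp: summable_on_def)
    moreover have "(\<lambda>j. T (i, j)) sums r i"
      unfolding T_def r_def prod.case by (intro sums_mult binom) (use z in simp)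
    ultimately show "((\<lambda>j. T (i, j)) has_sum r i) UNIV"
      using has_sum_imp_sums[OF y] sums_unique2 by metis
  qed
  then have "r sums X" by (rule has_sum_imp_sums)
  moreover have "r sums ((1 - z) powr (- of_real b) * S)"
  proof -
    have "r = (\<lambda>i. (1 - z) powr (- of_real b) *
                 hyp2F1_term (of_real e) (of_real b) (of_real c) (z / (z - 1)) i)"
    proof
      fix i
      have "z / (z - 1) = (- z) / (1 - z)"
        by (metis minus_diff_eq minus_divide_divide)
      then have "(z / (z - 1)) ^ i = (- z) ^ i / (1 - z) ^ i" by (simp only: power_divide)
      then show "r i = (1 - z) powr (- of_real b) *
                 hyp2F1_term (of_real e) (of_real b) (of_real c) (z / (z - 1)) i"
        by (simp add: r_def hyp2F1_term_def h_def pochhammer_of_real mult_ac)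
    qed
    with sums_mult[OF S] show ?thesis by simp
  qed
  ultimately have X_eq: "X = (1 - z) powr (- of_real b) * S" by (rule sums_unique2)
  \<comment> \<open>The second summation order: along the antidiagonals \<open>i + j = n\<close>, which collect the coefficient of \<open>z ^ n\<close>.\<close>
  have "((\<lambda>(n,i). T (i, n - i)) has_sum X) (Sigma UNIV (\<lambda>n. {..n}))"
    by (rule has_sum_reindex_bij_witness[THEN iffD2, OF _ _ _ _ _ refl X,
          of _ "\<lambda>(i,j). (i + j, i)" "\<lambda>(n,i). (i, n - i)"]) auto
  then have "((\<lambda>n. \<Sum>i\<le>n. T (i, n - i)) has_sum X) UNIV"
    by (rule has_sum_SigmaD) simp
  then have "(\<lambda>n. \<Sum>i\<le>n. T (i, n - i)) sums X" by (rule has_sum_imp_sums)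
  also have "(\<lambda>n. \<Sum>i\<le>n. T (i, n - i)) = hyp2F1_term (of_real (c - e)) (of_real b) (of_real c) z"
  proof
    fix n
    have "(\<Sum>i\<le>n. T (i, n - i)) = (\<Sum>i\<le>n. of_real ((-1) ^ i * h i * p i (n - i)) * z ^ n)"
    proof (rule sum.cong[OF refl])
      fix i assume "i \<in> {..n}"
      then have "z ^ n = z ^ i * z ^ (n - i)" by (simp flip: power_add)
      moreover have "(- z) ^ i = (-1) ^ i * z ^ i" by (rule power_minus)
      ultimately show "T (i, n - i) = of_real ((-1) ^ i * h i * p i (n - i)) * z ^ n"
        by (simp add: T_def)
    qed
    also have "\<dots> = of_real (\<Sum>i\<le>n. (-1) ^ i * h i * p i (n - i)) * z ^ n"
      by (simp only: of_real_sum sum_distrib_right)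
    also have "(\<Sum>i\<le>n. (-1) ^ i * h i * p i (n - i)) =
        pochhammer (c - e) n * pochhammer b n / pochhammer c n / fact n"
      unfolding h_def p_def by (rule pfaff_coefficient[OF c])
    finally show "(\<Sum>i\<le>n. T (i, n - i)) = hyp2F1_term (of_real (c - e)) (of_real b) (of_real c) z n"
      by (simp add: hyp2F1_term_def pochhammer_of_real del: of_real_diff)
  qed
  finally show ?thesis unfolding X_eq .
qed

lemma norm_pfaff_argument_less_1:
  assumes "Re z < 1 / 2" shows "norm (z / (z - 1)) < 1"
proof -
  have "(norm z)\<^sup>2 < (norm (z - 1))\<^sup>2"
    using assms by (simp add: cmod_power2 power2_diff)
  then have "norm z < norm (z - 1)" by (rule power2_less_imp_less) simp
  then show ?thesis by (simp add: norm_divide divide_less_eq le_less_trans[OF norm_ge_zero])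
qed

text \<open>
  The map \<open>z \<mapsto> z / (z - 1)\<close> takes the half plane \<open>Re z < 1 / 2\<close> into the unit disc, so both sides
  are holomorphic there and the identity near 0 extends to the whole half plane.
\<close>
theorem pfaff_transformation:
  fixes b c e :: real
  assumes b: "b > 0" and c: "c > 0" and e: "e > 0" and z: "Re z < 1 / 2"
    and S: "hyp2F1_term (of_real e) (of_real b) (of_real c) (z / (z - 1)) sums S"
  shows "hyp2F1 (of_real (c - e)) (of_real b) (of_real c) z = (1 - z) powr (- of_real b) * S"
proof -
  obtain f where f: "f holomorphic_on cut_plane"
    "\<And>u. u \<in> ball 0 1 \<Longrightarrow> hyp2F1_term (of_real (c - e)) (of_real b) (of_real c) u sums f u"
    using hyp2F1_analytic_continuation[OF b c] by blast
  obtain g where g: "g holomorphic_on cut_plane"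
    "\<And>u. u \<in> ball 0 1 \<Longrightarrow> hyp2F1_term (of_real e) (of_real b) (of_real c) u sums g u"
    using hyp2F1_analytic_continuation[OF b c] by blast
  define H where "H = {z. Re z < 1 / 2}"
  have H_cut: "H \<subseteq> cut_plane" by (auto simp: H_def mem_cut_plane_iff)
  have H_arg: "w / (w - 1) \<in> ball 0 1" if "w \<in> H" for w
    using norm_pfaff_argument_less_1[of w] that by (simp add: H_def)
  have "f z = (1 - z) powr (- of_real b) * g (z / (z - 1))"
  proof (rule analytic_continuation_open[of "ball 0 (1/2)" H f
        "\<lambda>w. (1 - w) powr (- of_real b) * g (w / (w - 1))"])
    show "open H" unfolding H_def by (rule open_halfspace_Re_lt)
    show "connected H" unfolding H_def by (intro convex_connected convex_halfspace_Re_lt)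
    show "ball 0 (1/2) \<subseteq> H"
    proof
      fix w :: complex assume "w \<in> ball 0 (1/2)"
      then show "w \<in> H" using abs_Re_le_cmod[of w] by (simp add: H_def)
    qed
    show "f holomorphic_on H" using f(1) H_cut by (rule holomorphic_on_subset)
    have "g \<circ> (\<lambda>w. w / (w - 1)) holomorphic_on H"
    proof (rule holomorphic_on_compose_gen[OF _ g(1)])
      show "(\<lambda>w. w / (w - 1)) holomorphic_on H"
        by (intro holomorphic_intros) (auto simp: H_def)
      show "(\<lambda>w. w / (w - 1)) ` H \<subseteq> cut_plane" using H_arg ball_subset_cut_plane by blast
    qed
    moreover have "(\<lambda>w. (1 - w) powr (- of_real b)) holomorphic_on H"
      by (intro holomorphic_intros) (auto simp: H_def complex_nonpos_Reals_iff)
    ultimately show "(\<lambda>w. (1 - w) powr (- of_real b) * g (w / (w - 1))) holomorphic_on H"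
      by (intro holomorphic_on_mult) (simp_all add: o_def)
    show "f w = (1 - w) powr (- of_real b) * g (w / (w - 1))" if w: "w \<in> ball 0 (1/2)" for w
    proof -
      have "w \<in> H" using \<open>ball 0 (1/2) \<subseteq> H\<close> w by blast
      then have "hyp2F1_term (of_real (c - e)) (of_real b) (of_real c) w sums
          ((1 - w) powr (- of_real b) * g (w / (w - 1)))"
        using w by (intro pfaff_transformation_near_0 b c e g(2) H_arg) auto
      moreover have "hyp2F1_term (of_real (c - e)) (of_real b) (of_real c) w sums f w"
        using w by (intro f(2)) auto
      ultimately show ?thesis by (metis sums_unique2)
    qed
  qed (use z in \<open>auto simp: H_def\<close>)
  also have "g (z / (z - 1)) = S"
    using g(2)[OF H_arg] S z by (metis H_def mem_Collect_eq sums_unique2)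
  also have "f z = hyp2F1 (of_real (c - e)) (of_real b) (of_real c) z"
    using hyp2F1_eq_continuation[OF f] H_cut z by (auto simp: H_def)
  finally show ?thesis .
qed

section \<open>Absolute moments of the kernel\<close>

text \<open>
  Substitution of \<open>s\<^sup>2 / (A + s\<^sup>2)\<close> in the Beta integral over the unit interval.
\<close>
lemma half_line_beta_integral:
  fixes A a b :: real
  assumes A: "A > 0" and a: "a > 0" and b: "b > 0"
  shows "(\<integral>\<^sup>+t. ennreal (indicator {0<..} t * (t powr (2 * a - 1) * (A + t\<^sup>2) powr (- (a + b)))) \<partial>lborel)
         = ennreal (A powr (- b) * Beta a b / 2)"
proof -
  define g where "g = (\<lambda>s::real. s\<^sup>2 / (A + s\<^sup>2))"
  define g' where "g' = (\<lambda>s::real. 2 * A * s / (A + s\<^sup>2)\<^sup>2)"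
  define f where "f = (\<lambda>x::real. x powr (a - 1) * (1 - x) powr (b - 1))"
  have pos: "A + s\<^sup>2 > 0" for s using A by (simp add: add_pos_nonneg)
  have img: "g ` {0<..} = {0<..<1}"
  proof (intro equalityI subsetI)
    fix y assume y: "y \<in> {0<..<1::real}"
    define s where "s = sqrt (A * y / (1 - y))"
    have "s > 0" "s\<^sup>2 = A * y / (1 - y)" using y A by (simp_all add: s_def)
    moreover have "A + A * y / (1 - y) = A / (1 - y)" using y by (simp add: field_simps)
    ultimately have "g s = y" using y A by (simp add: g_def)
    then show "y \<in> g ` {0<..}" using \<open>s > 0\<close> by force
  qed (use A pos in \<open>auto simp: g_def divide_simps\<close>)
  have inj: "inj_on g {0<..}"
  proof (rule inj_onI)
    fix s t :: real assume st: "s \<in> {0<..}" "t \<in> {0<..}" "g s = g t"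
    then have "s\<^sup>2 * (A + t\<^sup>2) = t\<^sup>2 * (A + s\<^sup>2)"
      using pos[of s] pos[of t] by (simp add: g_def frac_eq_eq)
    then have "s\<^sup>2 = t\<^sup>2" using A by (simp add: algebra_simps)
    then show "s = t" using st by simp
  qed
  have der: "(g has_field_derivative g' s) (at s within {0<..})" for s
    using pos[of s] unfolding g_def g'_def
    by (auto intro!: derivative_eq_intros simp: power2_eq_square field_simps)
  have "(f has_integral Beta a b) {0<..<1}"
    using has_integral_Beta_real[OF a b] by (simp add: f_def has_integral_Icc_iff_Ioo)
  moreover from this have "f absolutely_integrable_on {0<..<1}"
    by (intro nonnegative_absolutely_integrable_1) (auto simp: f_def)
  ultimately have "(\<lambda>s. \<bar>g' s\<bar> * f (g s)) absolutely_integrable_on {0<..} \<and>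
      integral {0<..} (\<lambda>s. \<bar>g' s\<bar> * f (g s)) = Beta a b"
    using has_absolute_integral_change_of_variables_1'[of "{0<..}" g g' f "Beta a b"] der inj img
    by (auto simp: integral_unique)
  then have "((\<lambda>s. \<bar>g' s\<bar> * f (g s)) has_integral Beta a b) {0<..}"
    by (metis has_integral_iff set_lebesgue_integral_eq_integral(1))
  then have "((\<lambda>s. \<bar>g' s\<bar> * f (g s) * (A powr (- b) / 2)) has_integral
       Beta a b * (A powr (- b) / 2)) {0<..}"
    by (rule has_integral_mult_left)
  also have "?this \<longleftrightarrow> ((\<lambda>t. t powr (2 * a - 1) * (A + t\<^sup>2) powr (- (a + b))) has_integral
       Beta a b * (A powr (- b) / 2)) {0<..}"
  proof (rule has_integral_cong)
    fix t :: real assume "t \<in> {0<..}"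
    then have t: "t > 0" by simp
    define Q where "Q = A + t\<^sup>2"
    have Q: "Q > 0" using pos by (simp add: Q_def)
    have "1 - g t = A / Q" using Q by (simp add: g_def Q_def field_simps)
    then have "\<bar>g' t\<bar> * f (g t) * (A powr (- b) / 2) =
        (A * A powr (b - 1) * A powr (- b)) * (t * (t\<^sup>2) powr (a - 1))
        / (Q\<^sup>2 * Q powr (a - 1) * Q powr (b - 1))"
    proof -
      have "g t = t\<^sup>2 / Q" "\<bar>g' t\<bar> = 2 * A * t / Q\<^sup>2" using t A by (simp_all add: g_def g'_def Q_def)
      moreover have "(t\<^sup>2 / Q) powr (a - 1) = (t\<^sup>2) powr (a - 1) / Q powr (a - 1)"
        "(A / Q) powr (b - 1) = A powr (b - 1) / Q powr (b - 1)"
        using Q A by (simp_all add: powr_divide)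
      moreover have "2 * A * t / q * (X / Y * (Z / W)) * (D / 2) =
          (A * Z * D) * (t * X) / (q * Y * W)" for q X Y Z W D :: real
        by (simp add: mult_ac)
      ultimately show ?thesis using \<open>1 - g t = A / Q\<close> by (simp only: f_def)
    qed
    also have "A * A powr (b - 1) * A powr (- b) = 1"
      using A by (simp add: powr_mult_base powr_add[symmetric])
    also have "t * (t\<^sup>2) powr (a - 1) = t powr (2 * a - 1)"
      using t by (simp add: powr_powr powr_mult_base flip: powr_numeral)
    also have "Q\<^sup>2 * Q powr (a - 1) * Q powr (b - 1) = Q powr (a + b)"
      using Q by (simp add: powr_add[symmetric] flip: powr_numeral)
    finally show "\<bar>g' t\<bar> * f (g t) * (A powr (- b) / 2) = t powr (2 * a - 1) * (A + t\<^sup>2) powr (- (a + b))"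
      by (simp only: Q_def powr_minus_divide mult_1 times_divide_eq_right mult_1_right)
  qed
  finally have "((\<lambda>t. indicator {0<..} t * (t powr (2 * a - 1) * (A + t\<^sup>2) powr (- (a + b)))) has_integral
       Beta a b * (A powr (- b) / 2)) UNIV"
    by (subst (asm) has_integral_restrict_UNIV[symmetric])
       (rule has_integral_eq[rotated], assumption, simp add: indicator_def)
  from nn_integral_has_integral_lborel[OF _ _ this] show ?thesis
    by (simp add: mult_ac)
qed

lemma nn_integral_fold_half_line:
  fixes h :: "real \<Rightarrow> ennreal"
  assumes [measurable]: "h \<in> borel_measurable borel"
  shows "(\<integral>\<^sup>+t. h t \<partial>lborel) = (\<integral>\<^sup>+t. indicator {0<..} t * (h t + h (- t)) \<partial>lborel)"
proof -
  have "(\<integral>\<^sup>+t. h t \<partial>lborel) = (\<integral>\<^sup>+t. indicator {0<..} t * h t + indicator {..<0} t * h t \<partial>lborel)"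
  proof (rule nn_integral_cong_AE)
    show "AE t in lborel. h t = indicator {0<..} t * h t + indicator {..<0} t * h t"
      using AE_lborel_singleton[of 0] by eventually_elim (auto simp: indicator_def)
  qed
  also have "\<dots> = (\<integral>\<^sup>+t. indicator {0<..} t * h t \<partial>lborel) + (\<integral>\<^sup>+t. indicator {..<0} t * h t \<partial>lborel)"
    by (rule nn_integral_add) auto
  also have "(\<integral>\<^sup>+t. indicator {..<0} t * h t \<partial>lborel) = (\<integral>\<^sup>+t. indicator {0<..} t * h (- t) \<partial>lborel)"
    by (subst nn_integral_real_affine[where c = "-1" and t = 0]) (auto simp: indicator_def)
  also have "(\<integral>\<^sup>+t. indicator {0<..} t * h t \<partial>lborel) + \<dots> =
      (\<integral>\<^sup>+t. indicator {0<..} t * (h t + h (- t)) \<partial>lborel)"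
    by (subst nn_integral_add[symmetric]) (auto simp: distrib_left)
  finally show ?thesis .
qed

lemma binomial_series_real:
  fixes p y :: real
  assumes "\<bar>y\<bar> < 1"
  shows "(\<lambda>n. pochhammer p n / fact n * y ^ n) sums (1 - y) powr (- p)"
proof -
  have "(\<lambda>n. complex_of_real (pochhammer p n / fact n * y ^ n)) sums of_real ((1 - y) powr (- p))"
    using binomial_series_complex[of "of_real y" "of_real p"] assms
    by (simp add: pochhammer_of_real powr_of_real[symmetric])
  then show ?thesis by (simp only: sums_of_real_iff)
qed

text \<open>
  The sum over the two signs of \<open>y\<close> keeps only the even powers, so that for \<open>p > 0\<close> all terms are
  nonnegative.
\<close>
lemma binomial_series_even_part:
  fixes p Q y :: real
  assumes Q: "Q > 0" and y: "\<bar>y\<bar> < Q"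
  shows "(\<lambda>i. 2 * pochhammer p (2 * i) / fact (2 * i) * y ^ (2 * i) * Q powr (- (p + 2 * real i)))
           sums ((Q - y) powr (- p) + (Q + y) powr (- p))"
proof -
  define c where "c = (\<lambda>n. pochhammer p n / fact n)"
  have "\<bar>y / Q\<bar> < 1" using assms by simp
  from sums_add[OF binomial_series_real[OF this, of p] binomial_series_real[of "- (y / Q)" p]] this
  have "(\<lambda>n. c n * (y / Q) ^ n + c n * (- (y / Q)) ^ n) sums ((1 - y / Q) powr (- p) + (1 + y / Q) powr (- p))"
    by (simp add: c_def)
  moreover have "c n * (y / Q) ^ n + c n * (- (y / Q)) ^ n = 0" if "n \<notin> range ((*) 2)" for n :: nat
  proof -
    have "odd n" using that by (auto elim!: evenE)
    then show ?thesis by simp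
  qed
  ultimately have "(\<lambda>i. c (2 * i) * (y / Q) ^ (2 * i) + c (2 * i) * (- (y / Q)) ^ (2 * i)) sums
       ((1 - y / Q) powr (- p) + (1 + y / Q) powr (- p))"
    by (subst sums_mono_reindex[of "(*) 2"]) (auto simp: strict_mono_def)
  from sums_mult[OF this, of "Q powr (- p)"]
  have "(\<lambda>i. Q powr (- p) * (2 * (c (2 * i) * (y / Q) ^ (2 * i)))) sums
      (Q powr (- p) * (1 - y / Q) powr (- p) + Q powr (- p) * (1 + y / Q) powr (- p))"
    by (simp add: distrib_left)
  also have "Q powr (- p) * (1 - y / Q) powr (- p) = (Q - y) powr (- p)"
    using assms by (subst powr_mult[symmetric]) (auto simp: algebra_simps)
  also have "Q powr (- p) * (1 + y / Q) powr (- p) = (Q + y) powr (- p)"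
    using assms by (subst powr_mult[symmetric]) (auto simp: algebra_simps)
  also have "(\<lambda>i. Q powr (- p) * (2 * (c (2 * i) * (y / Q) ^ (2 * i)))) =
     (\<lambda>i. 2 * pochhammer p (2 * i) / fact (2 * i) * y ^ (2 * i) * Q powr (- (p + 2 * real i)))"
  proof
    fix i
    have "Q powr (- (p + 2 * real i)) = Q powr (- p) / Q ^ (2 * i)"
      using Q by (simp add: powr_diff powr_realpow[symmetric])
    then show "Q powr (- p) * (2 * (c (2 * i) * (y / Q) ^ (2 * i))) =
        2 * pochhammer p (2 * i) / fact (2 * i) * y ^ (2 * i) * Q powr (- (p + 2 * real i))"
      by (simp add: c_def power_divide)
  qed
  finally show ?thesis .
qed

lemma Beta_shift_both:
  fixes a b :: real
  assumes "a > 0" "b > 0"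
  shows "pochhammer (a + b) (2 * i) * Beta (a + real i) (b + real i) =
     pochhammer a i * pochhammer b i * Beta a b"
proof -
  have "a \<notin> \<int>\<^sub>\<le>\<^sub>0" "b \<notin> \<int>\<^sub>\<le>\<^sub>0" "a + b \<notin> \<int>\<^sub>\<le>\<^sub>0" using assms by (auto elim!: nonpos_Ints_cases)
  moreover have "Gamma a \<noteq> 0" "Gamma b \<noteq> 0" "Gamma (a + b) \<noteq> 0" "Gamma (a + real i + (b + real i)) \<noteq> 0"
    using assms by (auto intro!: less_imp_neq[THEN not_sym] Gamma_real_pos)
  moreover have "pochhammer (a + b) (2 * i) = Gamma (a + real i + (b + real i)) / Gamma (a + b)"
    using \<open>a + b \<notin> \<int>\<^sub>\<le>\<^sub>0\<close> by (simp add: pochhammer_Gamma algebra_simps)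
  ultimately show ?thesis by (simp add: Beta_def pochhammer_Gamma)
qed

text \<open>
  Term by term integration of \<open>binomial_series_even_part\<close> with \<open>Q = A + t\<^sup>2\<close> and \<open>y = 2 * \<mu> * t\<close>.
  The factor \<open>pochhammer p (2 * i)\<close> cancels against the Beta function by \<open>Beta_shift_both\<close>, and
  \<open>fact (2 * i)\<close> contributes \<open>4 ^ i\<close>, \<open>fact i\<close> and \<open>pochhammer (1 / 2) i\<close>, which leaves a
  hypergeometric series in \<open>\<mu>\<^sup>2 / A\<close>.
\<close>
lemma nn_integral_abs_moment_kernel:
  fixes d p \<mu> b S :: real and k :: nat
  assumes d: "d > 0" and b: "b > 0" and p: "p = (real k + 1) / 2 + b"
    and S: "(\<lambda>i. pochhammer ((real k + 1) / 2) i * pochhammer b i / pochhammer (1 / 2) i / fact i *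
        (\<mu>\<^sup>2 / (d + \<mu>\<^sup>2)) ^ i) sums S"
  shows "(\<integral>\<^sup>+t. ennreal (\<bar>t\<bar> ^ k * (d + (t - \<mu>)\<^sup>2) powr (- p)) \<partial>lborel) =
     ennreal ((d + \<mu>\<^sup>2) powr (- b) * Beta ((real k + 1) / 2) b * S)"
proof -
  define \<alpha> where "\<alpha> = (real k + 1) / 2"
  define A where "A = d + \<mu>\<^sup>2"
  have \<alpha>: "\<alpha> > 0" by (simp add: \<alpha>_def)
  have A: "A > 0" using d by (simp add: A_def add_pos_nonneg)
  have p_eq: "p = \<alpha> + b" by (simp add: p \<alpha>_def)
  define C where "C = (\<lambda>i. 2 * pochhammer p (2 * i) / fact (2 * i) * (2 * \<mu>) ^ (2 * i))"
  have C_nonneg: "C i \<ge> 0" for i using \<alpha> b by (simp add: C_def p_eq pochhammer_nonneg)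
  define u where "u = (\<lambda>i t. C i * (indicator {0<..} t *
      (t powr (2 * (\<alpha> + real i) - 1) * (A + t\<^sup>2) powr (- ((\<alpha> + real i) + (b + real i))))))"
  define h where "h = (\<lambda>t. \<bar>t\<bar> ^ k * (d + (t - \<mu>)\<^sup>2) powr (- p))"
  define a where "a = (\<lambda>i. pochhammer \<alpha> i * pochhammer b i / pochhammer (1 / 2) i / fact i * (\<mu>\<^sup>2 / A) ^ i)"
  have a_nonneg: "a i \<ge> 0" for i using \<alpha> b A by (simp add: a_def pochhammer_nonneg)
  have u_meas[measurable]: "u i \<in> borel_measurable borel" for i by (simp add: u_def)
  have u_nonneg: "u i t \<ge> 0" for i t by (simp add: u_def C_nonneg)
  have expand: "ennreal (indicator {0<..} t) * (ennreal (h t) + ennreal (h (- t))) = (\<Sum>i. ennreal (u i t))" for t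
  proof (cases "t > 0")
    case t: True
    have Q: "A + t\<^sup>2 > 0" using A by (simp add: add_pos_nonneg)
    \<comment> \<open>This gives \<open>\<bar>2 * \<mu> * t\<bar> < A + t\<^sup>2\<close> for all \<open>t\<close> and \<open>\<mu>\<close>, so the binomial series converges without a smallness condition.\<close>
    have "0 \<le> (\<bar>t\<bar> - \<bar>\<mu>\<bar>)\<^sup>2" by simp
    then have "\<bar>2 * \<mu> * t\<bar> \<le> t\<^sup>2 + \<mu>\<^sup>2" by (simp add: power2_diff abs_mult mult_ac)
    then have "\<bar>2 * \<mu> * t\<bar> < A + t\<^sup>2" using d by (simp add: A_def)
    from sums_mult[OF binomial_series_even_part[OF Q this, of p], of "t ^ k"]
    have "(\<lambda>i. t ^ k * (2 * pochhammer p (2 * i) / fact (2 * i) * (2 * \<mu> * t) ^ (2 * i) * (A + t\<^sup>2) powr (- (p + 2 * real i))))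
       sums (t ^ k * ((A + t\<^sup>2 - 2 * \<mu> * t) powr (- p) + (A + t\<^sup>2 + 2 * \<mu> * t) powr (- p)))" .
    also have "t ^ k * ((A + t\<^sup>2 - 2 * \<mu> * t) powr (- p) + (A + t\<^sup>2 + 2 * \<mu> * t) powr (- p)) = h t + h (- t)"
      using t by (simp add: h_def A_def power2_eq_square algebra_simps)
    also have "(\<lambda>i. t ^ k * (2 * pochhammer p (2 * i) / fact (2 * i) * (2 * \<mu> * t) ^ (2 * i) * (A + t\<^sup>2) powr (- (p + 2 * real i))))
        = (\<lambda>i. u i t)"
    proof
      fix i
      have "t powr (2 * (\<alpha> + real i) - 1) = t powr real (k + 2 * i)"
        by (rule arg_cong[where f = "(powr) t"]) (simp add: \<alpha>_def field_simps)
      also have "\<dots> = t ^ k * t ^ (2 * i)" using powr_realpow[OF t, of "k + 2 * i"] by (simp add: power_add)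
      finally show "t ^ k * (2 * pochhammer p (2 * i) / fact (2 * i) * (2 * \<mu> * t) ^ (2 * i) * (A + t\<^sup>2) powr (- (p + 2 * real i))) = u i t"
        using t by (simp add: u_def C_def p_eq power_mult_distrib add_ac)
    qed
    finally have "(\<lambda>i. u i t) sums (h t + h (- t))" .
    then have "(\<Sum>i. ennreal (u i t)) = ennreal (h t + h (- t))"
      by (subst suminf_ennreal2) (auto simp: u_nonneg sums_iff)
    then show ?thesis using t by (simp add: h_def ennreal_plus)
  qed (simp add: u_def)
  have term_int: "(\<integral>\<^sup>+t. ennreal (u i t) \<partial>lborel) = ennreal (A powr (- b) * Beta \<alpha> b * a i)" for i
  proof -
    have "(\<integral>\<^sup>+t. ennreal (u i t) \<partial>lborel) = ennreal (C i) *
        (\<integral>\<^sup>+t. ennreal (indicator {0<..} t *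
      (t powr (2 * (\<alpha> + real i) - 1) * (A + t\<^sup>2) powr (- ((\<alpha> + real i) + (b + real i))))) \<partial>lborel)"
      unfolding u_def by (subst nn_integral_cmult[symmetric]) (auto simp: ennreal_mult C_nonneg)
    also have "\<dots> = ennreal (C i) * ennreal (A powr (- (b + real i)) * Beta (\<alpha> + real i) (b + real i) / 2)"
      using A \<alpha> b by (subst half_line_beta_integral) auto
    also have "\<dots> = ennreal (C i * (A powr (- (b + real i)) * Beta (\<alpha> + real i) (b + real i) / 2))"
      by (rule ennreal_mult'[symmetric]) (rule C_nonneg)
    also have "C i * (A powr (- (b + real i)) * Beta (\<alpha> + real i) (b + real i) / 2) =
       (pochhammer (\<alpha> + b) (2 * i) * Beta (\<alpha> + real i) (b + real i)) * (4 ^ i * (\<mu>\<^sup>2) ^ i) / fact (2 * i) *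
         (A powr (- b) / A ^ i)"
      using A by (simp add: C_def p_eq powr_diff powr_realpow power_mult power_mult_distrib)
    also have "\<dots> = A powr (- b) * Beta \<alpha> b * a i"
      unfolding Beta_shift_both[OF \<alpha> b] fact_double a_def
      by (simp add: power_mult power_divide)
    finally show ?thesis .
  qed
  have a_sums: "a sums S" using S by (simp add: a_def \<alpha>_def A_def)
  have "(\<integral>\<^sup>+t. ennreal (h t) \<partial>lborel) = (\<integral>\<^sup>+t. ennreal (indicator {0<..} t) * (ennreal (h t) + ennreal (h (- t))) \<partial>lborel)"
    by (subst nn_integral_fold_half_line) (auto simp: h_def ennreal_indicator)
  also have "\<dots> = (\<Sum>i. \<integral>\<^sup>+t. ennreal (u i t) \<partial>lborel)"
    unfolding expand by (rule nn_integral_suminf) auto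
  also have "\<dots> = (\<Sum>i. ennreal (A powr (- b) * Beta \<alpha> b * a i))" by (simp only: term_int)
  also have "\<dots> = ennreal (A powr (- b) * Beta \<alpha> b * S)"
  proof -
    have "(\<lambda>i. A powr (- b) * Beta \<alpha> b * a i) sums (A powr (- b) * Beta \<alpha> b * S)"
      by (intro sums_mult a_sums)
    moreover have "Beta \<alpha> b \<ge> 0" using \<alpha> b by (simp add: Beta_def Gamma_real_pos less_imp_le)
    ultimately show ?thesis
      by (subst suminf_ennreal2) (auto simp: sums_iff a_nonneg)
  qed
  finally show ?thesis by (simp add: h_def A_def \<alpha>_def)
qed

text \<open>
  Pfaff's transformation moves the argument from \<open>\<mu>\<^sup>2 / (d + \<mu>\<^sup>2)\<close> to \<open>- \<mu>\<^sup>2 / d\<close> and replaces the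
  first parameter \<open>(k + 1) / 2\<close> by \<open>1 / 2 - (k + 1) / 2 = - k / 2\<close>. The real number \<open>H\<close> gives the value
  of the complex hypergeometric function, so that the moment can be stated over the reals.
\<close>
lemma abs_moment_kernel:
  fixes d p \<mu> b :: real and k :: nat
  assumes d: "d > 0" and b: "b > 0" and p: "p = (real k + 1) / 2 + b"
  obtains H where "hyp2F1 (of_real (- (real k / 2))) (of_real b) (1 / 2) (of_real (- (\<mu>\<^sup>2 / d))) = of_real H"
    and "has_bochner_integral lborel (\<lambda>t. \<bar>t\<bar> ^ k * (d + (t - \<mu>)\<^sup>2) powr (- p))
           (d powr (- b) * Beta ((real k + 1) / 2) b * H)"
proof -
  define \<alpha> where "\<alpha> = (real k + 1) / 2"
  define A where "A = d + \<mu>\<^sup>2"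
  define z where "z = - (\<mu>\<^sup>2 / d)"
  have \<alpha>: "\<alpha> > 0" by (simp add: \<alpha>_def)
  have A: "A > 0" using d by (simp add: A_def add_pos_nonneg)
  have z: "z \<le> 0" using d by (simp add: z_def)
  have z1: "1 - z = A / d" using d by (simp add: z_def A_def field_simps)
  have arg: "z / (z - 1) = \<mu>\<^sup>2 / A"
  proof -
    have "z / (z - 1) = (- z) / (1 - z)" by (metis minus_diff_eq minus_divide_divide)
    also have "\<dots> = \<mu>\<^sup>2 / A" using d A by (simp add: z1) (simp add: z_def)
    finally show ?thesis .
  qed
  define a where "a = (\<lambda>i. pochhammer \<alpha> i * pochhammer b i / pochhammer (1 / 2) i / fact i * (\<mu>\<^sup>2 / A) ^ i)"
  have a_nonneg: "a i \<ge> 0" for i using \<alpha> b A by (simp add: a_def pochhammer_nonneg)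
  obtain f where "\<And>u. u \<in> ball 0 1 \<Longrightarrow> hyp2F1_term (of_real \<alpha>) (of_real b) (of_real (1/2)) u sums f u"
    using hyp2F1_analytic_continuation[OF b, of "1/2" "of_real \<alpha>"] by auto
  moreover have "of_real (\<mu>\<^sup>2 / A) \<in> ball (0::complex) 1"
    unfolding mem_ball dist_0_norm norm_of_real using d A by (simp add: A_def)
  ultimately have "hyp2F1_term (of_real \<alpha>) (of_real b) (of_real (1/2)) (of_real (\<mu>\<^sup>2 / A)) sums f (of_real (\<mu>\<^sup>2 / A))"
    by blast
  then have "summable (\<lambda>i. complex_of_real (a i))"
    unfolding hyp2F1_term_of_real a_def by (rule sums_summable)
  then have "summable a" by (rule summable_of_real_iff[THEN iffD1])
  then obtain S where S: "a sums S" by (auto simp: summable_def)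
  have S_nonneg: "S \<ge> 0" using S a_nonneg by (metis sums_iff suminf_nonneg)
  have "hyp2F1_term (of_real \<alpha>) (of_real b) (of_real (1/2)) (of_real z / (of_real z - 1)) sums of_real S"
  proof -
    have "complex_of_real z / (of_real z - 1) = of_real (\<mu>\<^sup>2 / A)" by (simp flip: arg)
    moreover have "hyp2F1_term (of_real \<alpha>) (of_real b) (of_real (1/2)) (of_real (\<mu>\<^sup>2 / A)) =
        (\<lambda>i. of_real (a i))"
      by (rule ext) (simp only: hyp2F1_term_of_real a_def)
    ultimately show ?thesis using S by (simp only: sums_of_real_iff)
  qed
  from pfaff_transformation[OF b _ \<alpha> _ this] z
  have "hyp2F1 (of_real (1 / 2 - \<alpha>)) (of_real b) (of_real (1 / 2)) (of_real z) =
      (1 - of_real z) powr (- of_real b) * of_real S" by simp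
  also have "(1 - of_real z) powr (- of_real b) = complex_of_real ((1 - z) powr (- b))"
    using z by (simp add: powr_of_real[symmetric])
  also have "1 / 2 - \<alpha> = - (real k / 2)" by (simp add: \<alpha>_def field_simps)
  finally have "hyp2F1 (of_real (- (real k / 2))) (of_real b) (1 / 2) (of_real (- (\<mu>\<^sup>2 / d))) =
      of_real ((1 - z) powr (- b) * S)" by (simp add: z_def)
  moreover have "has_bochner_integral lborel (\<lambda>t. \<bar>t\<bar> ^ k * (d + (t - \<mu>)\<^sup>2) powr (- p))
           (d powr (- b) * Beta ((real k + 1) / 2) b * ((1 - z) powr (- b) * S))"
  proof (rule has_bochner_integral_nn_integral)
    have "Beta \<alpha> b \<ge> 0" using \<alpha> b by (simp add: Beta_def Gamma_real_pos less_imp_le)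
    then show "0 \<le> d powr - b * Beta ((real k + 1) / 2) b * ((1 - z) powr - b * S)"
      using S_nonneg by (simp add: \<alpha>_def)
    have "A powr (- b) = d powr (- b) * (1 - z) powr (- b)"
      using d A by (simp add: z1 powr_mult[symmetric])
    then show "(\<integral>\<^sup>+t. ennreal (\<bar>t\<bar> ^ k * (d + (t - \<mu>)\<^sup>2) powr (- p)) \<partial>lborel) =
        ennreal (d powr (- b) * Beta ((real k + 1) / 2) b * ((1 - z) powr (- b) * S))"
      using nn_integral_abs_moment_kernel[OF d b p, of \<mu> S] S
      by (simp add: a_def A_def \<alpha>_def mult_ac)
  qed auto
  ultimately show ?thesis using that by blast
qed

section \<open>Absolute and central moments of the Student density\<close>

lemma student_t_density_alt:
  assumes "\<nu> > 0" "\<sigma> > 0"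
  shows "student_t_density \<mu> \<sigma> \<nu> t =
    Gamma ((\<nu> + 1) / 2) / (Gamma (\<nu> / 2) * sqrt pi) * (\<nu> / \<sigma>) powr (\<nu> / 2) *
      (\<nu> / \<sigma> + (t - \<mu>)\<^sup>2) powr (- ((\<nu> + 1) / 2))"
proof -
  define d where "d = \<nu> / \<sigma>"
  have d: "d > 0" using assms by (simp add: d_def)
  have "sqrt (\<sigma> / (\<nu> * pi)) = d powr (- (1 / 2)) / sqrt pi"
  proof -
    have "\<sigma> / (\<nu> * pi) = inverse d / pi" by (simp add: d_def)
    then show ?thesis using d
      by (simp add: real_sqrt_divide real_sqrt_inverse powr_minus powr_half_sqrt)
  qed
  moreover have "(1 + \<sigma> / \<nu> * (t - \<mu>)\<^sup>2) powr (- ((\<nu> + 1) / 2)) =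
      d powr ((\<nu> + 1) / 2) * (d + (t - \<mu>)\<^sup>2) powr (- ((\<nu> + 1) / 2))"
  proof -
    have "1 + \<sigma> / \<nu> * (t - \<mu>)\<^sup>2 = (d + (t - \<mu>)\<^sup>2) / d"
      using assms by (simp add: d_def field_simps)
    then have "(1 + \<sigma> / \<nu> * (t - \<mu>)\<^sup>2) powr (- ((\<nu> + 1) / 2)) =
        (d + (t - \<mu>)\<^sup>2) powr (- ((\<nu> + 1) / 2)) / d powr (- ((\<nu> + 1) / 2))"
      using d by (simp add: powr_divide)
    then show ?thesis by (simp add: powr_minus_divide)
  qed
  moreover have "d powr (- (1 / 2)) * d powr ((\<nu> + 1) / 2) = d powr (\<nu> / 2)"
    by (simp add: powr_add[symmetric] add_divide_distrib)
  ultimately show ?thesis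
    by (simp add: student_t_density_def d_def[symmetric])
qed

lemma student_t_density_nonneg:
  "\<nu> > 0 \<Longrightarrow> \<sigma> > 0 \<Longrightarrow> student_t_density \<mu> \<sigma> \<nu> t \<ge> 0"
  by (simp add: student_t_density_def Gamma_real_pos less_imp_le)

lemma borel_measurable_student_t_density [measurable]:
  "student_t_density \<mu> \<sigma> \<nu> \<in> borel_measurable borel"
  unfolding student_t_density_def by measurable

lemma student_t_abs_moment:
  fixes \<mu> \<sigma> \<nu> :: real and k :: nat
  assumes \<nu>: "\<nu> > 0" and \<sigma>: "\<sigma> > 0" and k: "real k < \<nu>"
  obtains H where
    "hyp2F1 (of_real (- (real k / 2))) (of_real (\<nu> / 2 - real k / 2)) (1 / 2)
       (of_real (- (\<mu>\<^sup>2 * \<sigma> / \<nu>))) = of_real H"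
    "has_bochner_integral lborel (\<lambda>t. student_t_density \<mu> \<sigma> \<nu> t * \<bar>t\<bar> ^ k)
       ((\<nu> / \<sigma>) powr (real k / 2) * (Gamma ((real k + 1) / 2) / sqrt pi) *
        (Gamma (\<nu> / 2 - real k / 2) / Gamma (\<nu> / 2)) * H)"
proof -
  define d where "d = \<nu> / \<sigma>"
  define b where "b = \<nu> / 2 - real k / 2"
  have d: "d > 0" and b: "b > 0" using assms by (simp_all add: d_def b_def)
  define p where "p = (\<nu> + 1) / 2"
  have p: "p = (real k + 1) / 2 + b" by (simp add: p_def b_def field_simps)
  obtain H where H: "hyp2F1 (of_real (- (real k / 2))) (of_real b) (1 / 2) (of_real (- (\<mu>\<^sup>2 / d))) = of_real H"
    "has_bochner_integral lborel (\<lambda>t. \<bar>t\<bar> ^ k * (d + (t - \<mu>)\<^sup>2) powr (- p))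
           (d powr (- b) * Beta ((real k + 1) / 2) b * H)"
    using abs_moment_kernel[OF d b p] by blast
  define K where "K = Gamma p / (Gamma (\<nu> / 2) * sqrt pi) * d powr (\<nu> / 2)"
  have "has_bochner_integral lborel (\<lambda>t. K * (\<bar>t\<bar> ^ k * (d + (t - \<mu>)\<^sup>2) powr (- p)))
      (K * (d powr (- b) * Beta ((real k + 1) / 2) b * H))"
    by (rule has_bochner_integral_mult_right) (rule H(2))
  also have "(\<lambda>t. K * (\<bar>t\<bar> ^ k * (d + (t - \<mu>)\<^sup>2) powr (- p))) =
      (\<lambda>t. student_t_density \<mu> \<sigma> \<nu> t * \<bar>t\<bar> ^ k)"
    by (simp add: fun_eq_iff student_t_density_alt[OF \<nu> \<sigma>] K_def p_def d_def)
  also have "K * (d powr (- b) * Beta ((real k + 1) / 2) b * H) =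
      d powr (real k / 2) * (Gamma ((real k + 1) / 2) / sqrt pi) * (Gamma b / Gamma (\<nu> / 2)) * H"
  proof -
    have "Gamma p \<noteq> 0" using p b by (intro less_imp_neq[THEN not_sym] Gamma_real_pos) (simp add: add_nonneg_pos)
    moreover have "d powr (\<nu> / 2) * d powr (- b) = d powr (real k / 2)"
      by (simp add: powr_add[symmetric] b_def)
    moreover have "G / (W * s) * X * (Y * (A * B / G) * H) = Z * (A / s) * (B / W) * H"
      if "G \<noteq> 0" "X * Y = Z" for G W s X Y Z A B :: real
      using that by (auto simp: mult_ac)
    ultimately show ?thesis
      unfolding K_def Beta_def p[symmetric] by blast
  qed
  finally show ?thesis
    using that[of H] H(1) by (simp add: d_def b_def)
qed

lemma hyp2F1_at_0: "hyp2F1 a b c 0 = 1"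
proof -
  have "hyp2F1_term a b c 0 = (\<lambda>n. (if n = 0 then 1 else 0))"
    by (auto simp: hyp2F1_term_def fun_eq_iff)
  moreover have "(\<lambda>n::nat. (if n = 0 then 1 else 0)) sums (1::complex)"
    using sums_single[of 0 "\<lambda>_. 1::complex"] by simp
  ultimately show ?thesis by (simp add: hyp2F1_def sums_iff)
qed

lemma student_t_density_shift: "student_t_density \<mu> \<sigma> \<nu> (\<mu> + x) = student_t_density 0 \<sigma> \<nu> x"
  by (simp add: student_t_density_def)

text \<open>
  The absolute moment for location 0, where the hypergeometric factor is its value 1 at 0.
\<close>
lemma student_t_abs_central_moment:
  fixes \<mu> \<sigma> \<nu> :: real and k :: nat
  assumes \<nu>: "\<nu> > 0" and \<sigma>: "\<sigma> > 0" and k: "real k < \<nu>"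
  shows "has_bochner_integral lborel (\<lambda>t. student_t_density \<mu> \<sigma> \<nu> t * \<bar>t - \<mu>\<bar> ^ k)
       ((\<nu> / \<sigma>) powr (real k / 2) * (Gamma ((real k + 1) / 2) / sqrt pi) *
        (Gamma ((\<nu> - real k) / 2) / Gamma (\<nu> / 2)))"
proof -
  obtain H where H: "hyp2F1 (of_real (- (real k / 2))) (of_real (\<nu> / 2 - real k / 2)) (1 / 2)
       (of_real (- (0\<^sup>2 * \<sigma> / \<nu>))) = of_real H"
    "has_bochner_integral lborel (\<lambda>t. student_t_density 0 \<sigma> \<nu> t * \<bar>t\<bar> ^ k)
       ((\<nu> / \<sigma>) powr (real k / 2) * (Gamma ((real k + 1) / 2) / sqrt pi) *
        (Gamma (\<nu> / 2 - real k / 2) / Gamma (\<nu> / 2)) * H)"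
    using student_t_abs_moment[OF assms] by blast
  have "complex_of_real H = 1" using H(1) by (simp add: hyp2F1_at_0)
  then have "H = 1" by simp
  have half: "\<nu> / 2 - real k / 2 = (\<nu> - real k) / 2" by (simp add: diff_divide_distrib)
  show ?thesis
    using H(2)[unfolded half \<open>H = 1\<close>]
    by (subst lborel_has_bochner_integral_real_affine_iff[where c = 1 and t = \<mu>])
       (simp_all add: student_t_density_shift)
qed

text \<open>
  For odd \<open>k\<close> the reflection \<open>t \<mapsto> 2 * \<mu> - t\<close> changes the sign of the integrand.
\<close>
lemma student_t_central_moment:
  fixes \<mu> \<sigma> \<nu> :: real and k :: nat
  assumes \<nu>: "\<nu> > 0" and \<sigma>: "\<sigma> > 0" and k: "real k < \<nu>"
  shows "has_bochner_integral lborel (\<lambda>t. student_t_density \<mu> \<sigma> \<nu> t * (t - \<mu>) ^ k)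
       ((1 + (- 1) ^ k) / 2 * (\<nu> / \<sigma>) powr (real k / 2) * (Gamma ((real k + 1) / 2) / sqrt pi) *
        (Gamma ((\<nu> - real k) / 2) / Gamma (\<nu> / 2)))"
proof (cases "even k")
  case True
  then have "(\<bar>x\<bar> ^ k :: real) = x ^ k" for x by (simp add: power_even_abs)
  then show ?thesis using student_t_abs_central_moment[OF assms, of \<mu>] True by (simp add: mult_ac)
next
  case False
  let ?f = "\<lambda>t. student_t_density \<mu> \<sigma> \<nu> t * (t - \<mu>) ^ k"
  have "integrable lborel ?f"
  proof (rule Bochner_Integration.integrable_bound)
    show "integrable lborel (\<lambda>t. student_t_density \<mu> \<sigma> \<nu> t * \<bar>t - \<mu>\<bar> ^ k)"
      using student_t_abs_central_moment[OF assms, of \<mu>] by (simp add: has_bochner_integral_iff)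
  qed (auto simp: abs_mult power_abs)
  moreover have "integral\<^sup>L lborel ?f = - integral\<^sup>L lborel ?f"
  proof -
    have "integral\<^sup>L lborel ?f = (\<integral>x. ?f (2 * \<mu> + (- 1) * x) \<partial>lborel)"
      using lborel_integral_real_affine[of "- 1" ?f "2 * \<mu>"] by simp
    also have "(\<lambda>x. ?f (2 * \<mu> + (- 1) * x)) = (\<lambda>x. - ?f x)"
    proof
      fix x
      have "student_t_density \<mu> \<sigma> \<nu> (2 * \<mu> + (- 1) * x) = student_t_density \<mu> \<sigma> \<nu> x"
        using power2_commute[of \<mu> x] by (simp add: student_t_density_def)
      moreover have "(2 * \<mu> + (- 1) * x - \<mu>) ^ k = - ((x - \<mu>) ^ k)"
        using power_minus_odd[OF False, of "x - \<mu>"] by simp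
      ultimately show "?f (2 * \<mu> + (- 1) * x) = - ?f x" by simp
    qed
    finally show ?thesis by simp
  qed
  ultimately show ?thesis using False by (simp add: has_bochner_integral_iff)
qed

section \<open>Odd raw moments\<close>

text \<open>
  The even indices up to \<open>2 * n + 1\<close> are listed in decreasing order, so that the summation variable
  becomes the index of the hypergeometric polynomial.
\<close>
lemma sum_even_odd_degree:
  fixes g :: "nat \<Rightarrow> real"
  assumes "\<And>j. odd j \<Longrightarrow> g j = 0"
  shows "(\<Sum>j\<le>2 * n + 1. g j) = (\<Sum>l\<le>n. g (2 * (n - l)))"
proof -
  have "(\<Sum>j\<le>2 * n + 1. g j) = (\<Sum>j\<in>(*) 2 ` {..n}. g j)"
  proof (rule sum.mono_neutral_right)
    show "\<forall>j\<in>{..2 * n + 1} - (*) 2 ` {..n}. g j = 0"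
    proof
      fix j assume j: "j \<in> {..2 * n + 1} - (*) 2 ` {..n}"
      have "odd j"
      proof
        assume "even j"
        then obtain i where "j = 2 * i" by (rule evenE)
        with j show False by auto
      qed
      then show "g j = 0" by (rule assms)
    qed
  qed auto
  also have "\<dots> = (\<Sum>i\<le>n. g (2 * i))" by (subst sum.reindex) (auto simp: inj_on_def)
  also have "\<dots> = (\<Sum>l\<le>n. g (2 * (n - l)))"
    by (rule sum.reindex_bij_witness[of _ "\<lambda>l. n - l" "\<lambda>l. n - l"]) auto
  finally show ?thesis .
qed

lemma fact_double_Suc:
  "fact (2 * l + 1) = (4 ^ l * fact l * pochhammer (3 / 2) l :: real)"
proof (induction l)
  case (Suc l)
  have "fact (2 * Suc l + 1) = (2 * real l + 3) * (2 * real l + 2) * (fact (2 * l + 1) :: real)"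
    by (simp add: algebra_simps)
  then show ?case using Suc by (simp add: pochhammer_Suc algebra_simps)
qed simp

lemma Gamma_half_plus_nat: "Gamma (real n + 1 / 2) = sqrt pi * fact (2 * n) / (4 ^ n * fact n)"
proof -
  have half: "(1 / 2 :: real) \<notin> \<int>\<^sub>\<le>\<^sub>0" by (auto elim!: nonpos_Ints_cases)
  have "Gamma (real n + 1 / 2) = sqrt pi * pochhammer (1 / 2) n"
    using pochhammer_Gamma[OF half, of n] by (simp add: Gamma_one_half_real add.commute)
  moreover have "fact (2 * n) = (4 ^ n * pochhammer (1 / 2) n * fact n :: real)"
    by (simp add: fact_double power_mult)
  ultimately show ?thesis by simp
qed

text \<open>
  Both sides equal \<open>fact (2 * n + 1) * sqrt pi\<close> divided by \<open>4 ^ n * fact (n - l) * fact l\<close> and by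
  \<open>pochhammer (3 / 2) l\<close>: Gamma values at half-integers and \<open>fact (2 * l + 1)\<close> are expressed by
  factorials and rising factorials.
\<close>
lemma odd_moment_coefficient:
  assumes "l \<le> n"
  shows "real ((2 * n + 1) choose (2 * (n - l))) * Gamma (real (n - l) + 1 / 2) =
     2 * Gamma (real n + 3 / 2) * ((-1) ^ l * pochhammer (- real n) l) / (pochhammer (3 / 2) l * fact l)"
proof -
  define j where "j = n - l"
  have n: "n = j + l" using assms by (simp add: j_def)
  have P: "pochhammer (3 / 2 :: real) l > 0" by (simp add: pochhammer_pos)
  have "real ((2 * n + 1) choose (2 * j)) = fact (2 * n + 1) / (fact (2 * j) * fact (2 * l + 1))"
    using binomial_fact[of "2 * j" "2 * n + 1", where 'a = real] by (simp add: n)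
  then have "real ((2 * n + 1) choose (2 * j)) * Gamma (real j + 1 / 2) =
      fact (2 * n + 1) * sqrt pi / (4 ^ n * fact j * fact l * pochhammer (3 / 2) l)"
    unfolding Gamma_half_plus_nat fact_double_Suc[of l] by (simp add: n power_add mult_ac)
  moreover have "Gamma (real n + 3 / 2) = sqrt pi * fact (2 * n + 1) / (2 * 4 ^ n * fact n)"
  proof -
    have "Gamma (real n + 3 / 2) = sqrt pi * fact (2 * Suc n) / (4 ^ Suc n * fact (Suc n))"
      using Gamma_half_plus_nat[of "Suc n"] by (simp add: add_ac)
    also have "fact (2 * Suc n) = (2 * (real n + 1)) * (fact (2 * n + 1) :: real)"
      by (simp add: algebra_simps)
    also have "sqrt pi * (2 * (real n + 1) * fact (2 * n + 1)) / (4 ^ Suc n * fact (Suc n)) =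
        sqrt pi * fact (2 * n + 1) / (2 * 4 ^ n * fact n)"
    proof -
      have "s * (2 * m * F) / (4 * E * (m * G)) = s * F / (2 * E * G)" if "m \<noteq> 0" for s m F E G :: real
        using that by (simp add: mult_ac)
      from this[of "real n + 1" "sqrt pi" "fact (2 * n + 1)" "4 ^ n" "fact n"] show ?thesis
        by (simp add: add.commute)
    qed
    finally show ?thesis .
  qed
  moreover have "(-1) ^ l * pochhammer (- real n) l = fact n / fact j"
  proof -
    have "(-1::real) ^ l * (-1) ^ l = 1" by (simp flip: power_mult_distrib)
    then show ?thesis
      by (simp add: pochhammer_neg_of_nat[OF assms] j_def mult.assoc[symmetric])
  qed
  ultimately show ?thesis using P by (simp add: j_def[symmetric] mult_ac)
qed

lemma hyp2F1_nonpos_int: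
  assumes "a = - of_nat n"
  shows "hyp2F1 a b c z = (\<Sum>l\<le>n. hyp2F1_term a b c z l)"
proof -
  have "hyp2F1_term a b c z sums (\<Sum>l\<in>{..n}. hyp2F1_term a b c z l)"
  proof (rule sums_finite)
    fix l assume "l \<notin> {..n}"
    then have "pochhammer a l = 0"
      using assms by (auto simp: pochhammer_of_nat_eq_0_iff)
    then show "hyp2F1_term a b c z l = 0" by (simp add: hyp2F1_term_def)
  qed simp
  then show ?thesis by (simp add: hyp2F1_def sums_iff)
qed

text \<open>
  Expand \<open>t ^ k\<close> around \<open>\<mu>\<close>. Only the central moments of even order \<open>2 * (n - l)\<close> remain, and they
  give the terms of a hypergeometric polynomial in \<open>- \<mu>\<^sup>2 / d\<close> of degree \<open>n\<close>.
\<close>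
lemma student_t_odd_moment:
  fixes \<mu> \<sigma> \<nu> :: real and k n :: nat
  assumes \<nu>: "\<nu> > 0" and \<sigma>: "\<sigma> > 0" and k: "real k < \<nu>" and kn: "k = 2 * n + 1"
  obtains H where
    "hyp2F1 (of_real ((1 - real k) / 2)) (of_real (\<nu> / 2 - (real k - 1) / 2)) (3 / 2)
       (of_real (- (\<mu>\<^sup>2 * \<sigma> / \<nu>))) = of_real H"
    "has_bochner_integral lborel (\<lambda>t. student_t_density \<mu> \<sigma> \<nu> t * t ^ k)
       (2 * \<mu> * (\<nu> / \<sigma>) powr ((real k - 1) / 2) * (Gamma (real k / 2 + 1) / sqrt pi) *
        (Gamma (\<nu> / 2 - (real k - 1) / 2) / Gamma (\<nu> / 2)) * H)"
proof -
  define d where "d = \<nu> / \<sigma>"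
  define b where "b = \<nu> / 2 - real n"
  have d: "d > 0" and b: "b > 0" using assms by (simp_all add: d_def b_def)
  define c where "c = (\<lambda>j. (1 + (- 1) ^ j) / 2 * d powr (real j / 2) * (Gamma ((real j + 1) / 2) / sqrt pi) *
        (Gamma ((\<nu> - real j) / 2) / Gamma (\<nu> / 2)))"
  define H where "H = (\<Sum>l\<le>n. pochhammer (- real n) l * pochhammer b l / pochhammer (3 / 2) l / fact l *
        (- (\<mu>\<^sup>2 / d)) ^ l)"
  define f where "f = (\<lambda>t. \<Sum>j\<le>k. real (k choose j) * \<mu> ^ (k - j) * (student_t_density \<mu> \<sigma> \<nu> t * (t - \<mu>) ^ j))"
  have "has_bochner_integral lborel f (\<Sum>j\<le>k. real (k choose j) * \<mu> ^ (k - j) * c j)"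
    unfolding f_def c_def d_def
    by (intro has_bochner_integral_sum has_bochner_integral_mult_right student_t_central_moment \<nu> \<sigma>)
       (use k in auto)
  moreover have "f = (\<lambda>t. student_t_density \<mu> \<sigma> \<nu> t * t ^ k)"
  proof
    fix t
    show "f t = student_t_density \<mu> \<sigma> \<nu> t * t ^ k"
      using binomial_ring[of "t - \<mu>" \<mu> k] by (simp add: f_def sum_distrib_left mult_ac)
  qed
  moreover have "(\<Sum>j\<le>k. real (k choose j) * \<mu> ^ (k - j) * c j) =
      2 * \<mu> * d ^ n * (Gamma (real n + 3 / 2) / sqrt pi) * (Gamma b / Gamma (\<nu> / 2)) * H"
  proof -
    have "(\<Sum>j\<le>k. real (k choose j) * \<mu> ^ (k - j) * c j) =
        (\<Sum>l\<le>n. real (k choose (2 * (n - l))) * \<mu> ^ (k - 2 * (n - l)) * c (2 * (n - l)))"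
      unfolding kn by (rule sum_even_odd_degree) (simp add: c_def)
    also have "\<dots> = (\<Sum>l\<le>n. 2 * \<mu> * d ^ n * (Gamma (real n + 3 / 2) / sqrt pi) * (Gamma b / Gamma (\<nu> / 2)) *
        (pochhammer (- real n) l * pochhammer b l / pochhammer (3 / 2) l / fact l * (- (\<mu>\<^sup>2 / d)) ^ l))"
    proof (rule sum.cong[OF refl])
      fix l assume "l \<in> {..n}"
      then have l: "l \<le> n" by simp
      define j where "j = n - l"
      have n: "n = j + l" using l by (simp add: j_def)
      have c1: "d powr (real (2 * j) / 2) = d ^ n / d ^ l"
        using d by (simp add: powr_realpow n power_add)
      have c2: "(real (2 * j) + 1) / 2 = real j + 1 / 2" by (simp add: field_simps)
      have c3: "Gamma ((\<nu> - real (2 * j)) / 2) = Gamma b * pochhammer b l"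
      proof -
        have "b \<notin> \<int>\<^sub>\<le>\<^sub>0" "Gamma b \<noteq> 0" 
          using b less_imp_neq[OF Gamma_real_pos[OF b]] by (auto elim!: nonpos_Ints_cases)
        moreover have eq: "(\<nu> - real (2 * j)) / 2 = b + real l" by (simp add: b_def n field_simps)
        ultimately show ?thesis unfolding eq by (simp add: pochhammer_Gamma)
      qed
      have c: "c (2 * j) = d ^ n / d ^ l * (Gamma (real j + 1 / 2) / sqrt pi) *
           (Gamma b * pochhammer b l / Gamma (\<nu> / 2))"
        unfolding c_def c1 c2 c3 by simp
      have "\<mu> ^ (k - 2 * j) = \<mu> * (\<mu>\<^sup>2) ^ l"
        by (simp add: kn n power_mult)
      then have "real (k choose (2 * j)) * \<mu> ^ (k - 2 * j) * c (2 * j) =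
         (real (k choose (2 * j)) * Gamma (real j + 1 / 2)) * (\<mu> * (\<mu>\<^sup>2) ^ l * d ^ n / d ^ l *
           (Gamma b * pochhammer b l / Gamma (\<nu> / 2)) / sqrt pi)"
        unfolding c by (simp add: mult_ac)
      also have "real (k choose (2 * j)) * Gamma (real j + 1 / 2) =
          2 * Gamma (real n + 3 / 2) * ((-1) ^ l * pochhammer (- real n) l) / (pochhammer (3 / 2) l * fact l)"
        using odd_moment_coefficient[OF l] by (simp add: kn j_def)
      also have "\<dots> * (\<mu> * (\<mu>\<^sup>2) ^ l * d ^ n / d ^ l *
           (Gamma b * pochhammer b l / Gamma (\<nu> / 2)) / sqrt pi) =
         2 * \<mu> * d ^ n * (Gamma (real n + 3 / 2) / sqrt pi) * (Gamma b / Gamma (\<nu> / 2)) *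
        (pochhammer (- real n) l * pochhammer b l / pochhammer (3 / 2) l / fact l * ((-1) ^ l * ((\<mu>\<^sup>2) ^ l / d ^ l)))"
        by (simp add: mult_ac)
      also have "(-1) ^ l * ((\<mu>\<^sup>2) ^ l / d ^ l) = (- (\<mu>\<^sup>2 / d)) ^ l"
        by (subst (2) power_minus) (simp add: power_divide)
      finally show "real (k choose (2 * (n - l))) * \<mu> ^ (k - 2 * (n - l)) * c (2 * (n - l)) = 
         2 * \<mu> * d ^ n * (Gamma (real n + 3 / 2) / sqrt pi) * (Gamma b / Gamma (\<nu> / 2)) *
        (pochhammer (- real n) l * pochhammer b l / pochhammer (3 / 2) l / fact l * (- (\<mu>\<^sup>2 / d)) ^ l)"
        by (simp only: j_def)
    qed
    finally show ?thesis by (simp only: H_def sum_distrib_left)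
  qed
  moreover have "d powr ((real k - 1) / 2) = d ^ n" using d by (simp add: kn powr_realpow)
  moreover have "real k / 2 + 1 = real n + 3 / 2" by (simp add: kn field_simps)
  moreover have "\<nu> / 2 - (real k - 1) / 2 = b" by (simp add: kn b_def)
  ultimately have "has_bochner_integral lborel (\<lambda>t. student_t_density \<mu> \<sigma> \<nu> t * t ^ k)
       (2 * \<mu> * (\<nu> / \<sigma>) powr ((real k - 1) / 2) * (Gamma (real k / 2 + 1) / sqrt pi) *
        (Gamma (\<nu> / 2 - (real k - 1) / 2) / Gamma (\<nu> / 2)) * H)"
    by (simp only: d_def[symmetric])
  moreover have "hyp2F1 (of_real ((1 - real k) / 2)) (of_real (\<nu> / 2 - (real k - 1) / 2)) (3 / 2)
       (of_real (- (\<mu>\<^sup>2 * \<sigma> / \<nu>))) = of_real H"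
  proof -
    have "hyp2F1 (of_real (- real n)) (of_real b) (of_real (3 / 2)) (of_real (- (\<mu>\<^sup>2 / d))) = of_real H"
    proof -
      have "complex_of_real (- real n) = - of_nat n" by simp
      from hyp2F1_nonpos_int[OF this] show ?thesis
        by (simp only: hyp2F1_term_of_real H_def of_real_sum)
    qed
    moreover have "(1 - real k) / 2 = - real n" "\<nu> / 2 - (real k - 1) / 2 = b" "\<mu>\<^sup>2 * \<sigma> / \<nu> = \<mu>\<^sup>2 / d"
      by (simp_all add: kn b_def d_def)
    ultimately show ?thesis by simp
  qed
  ultimately show ?thesis using that by blast
qed

section \<open>Divergence of the moments of high order\<close>

text \<open>
  The integral up to \<open>b\<close> is \<open>ln b\<close>, which exceeds any candidate \<open>I\<close> for the value of the integral
  at \<open>b = exp (I + 1)\<close>.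
\<close>
lemma not_integrable_inverse_at_top:
  "\<not> integrable lborel (\<lambda>s::real. 1 / s * indicator {1..} s)"
proof
  let ?I = "\<lambda>b. \<integral>s. 1 / s * indicator {1..b} s \<partial>lborel"
  assume int: "integrable lborel (\<lambda>s::real. 1 / s * indicator {1..} s)"
  define I where "I = integral\<^sup>L lborel (\<lambda>s::real. 1 / s * indicator {1..} s)"
  have "I \<ge> 0" unfolding I_def by (rule Bochner_Integration.integral_nonneg) (auto simp: indicator_def)
  define b where "b = exp (I + 1)"
  have b: "b \<ge> 1" using \<open>I \<ge> 0\<close> by (simp add: b_def)
  have FTC: "has_bochner_integral lborel (\<lambda>s. 1 / s * indicator {1..b} s) (ln b - ln 1)"
  proof (rule has_bochner_integral_FTC_Icc_real)
    fix x :: real assume "1 \<le> x" "x \<le> b"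
    then show "DERIV ln x :> 1 / x" by (auto intro!: derivative_eq_intros)
    show "isCont (\<lambda>s. 1 / s) x" using \<open>1 \<le> x\<close> by (intro continuous_intros) auto
  qed (use b in auto)
  then have "ln b = ?I b" by (simp add: has_bochner_integral_iff)
  also have "\<dots> \<le> I"
    unfolding I_def using FTC int
    by (intro integral_mono) (auto simp: has_bochner_integral_iff indicator_def)
  finally show False by (simp add: b_def)
qed

text \<open>
  With \<open>d = \<nu> / \<sigma>\<close> and \<open>s = t - \<mu> \<ge> 1\<close> one has \<open>s ^ k \<ge> s powr \<nu>\<close> and \<open>d + s\<^sup>2 \<le> (d + 1) * s\<^sup>2\<close>, so the
  integrand is at least a positive multiple of \<open>1 / s\<close>.
\<close>
lemma student_t_moment_not_integrable:
  assumes \<nu>: "\<nu> > 0" and \<sigma>: "\<sigma> > 0" and k: "\<nu> \<le> real k"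
  shows "\<not> integrable lborel (\<lambda>t. student_t_density \<mu> \<sigma> \<nu> t * \<bar>t - \<mu>\<bar> ^ k)"
proof
  assume "integrable lborel (\<lambda>t. student_t_density \<mu> \<sigma> \<nu> t * \<bar>t - \<mu>\<bar> ^ k)"
  from lborel_integrable_real_affine[OF this, of 1 \<mu>]
  have int: "integrable lborel (\<lambda>s. student_t_density 0 \<sigma> \<nu> s * \<bar>s\<bar> ^ k)"
    by (simp add: student_t_density_shift)
  define d where "d = \<nu> / \<sigma>"
  define p where "p = (\<nu> + 1) / 2"
  define K where "K = Gamma p / (Gamma (\<nu> / 2) * sqrt pi) * d powr (\<nu> / 2)"
  have d: "d > 0" using assms by (simp add: d_def)
  have K: "K > 0" using \<nu> d by (simp add: K_def p_def Gamma_real_pos)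
  define c where "c = K * (d + 1) powr (- p)"
  have c: "c > 0" using K d by (simp add: c_def)
  have "integrable lborel (\<lambda>s. c * (1 / s * indicator {1..} s))"
  proof (rule Bochner_Integration.integrable_bound[OF int], simp, rule AE_I2)
    fix s :: real
    show "norm (c * (1 / s * indicator {1..} s)) \<le> norm (student_t_density 0 \<sigma> \<nu> s * \<bar>s\<bar> ^ k)"
    proof (cases "s \<ge> 1")
      case True
      have "c * (1 / s) = K * (s powr \<nu> * ((d + 1) * s\<^sup>2) powr (- p))"
      proof -
        have "(s\<^sup>2) powr (- p) = s powr (2 * (- p))"
          using True by (simp add: powr_powr flip: powr_numeral)
        also have "2 * (- p) = - (\<nu> + 1)" by (simp add: p_def field_simps)
        finally have "((d + 1) * s\<^sup>2) powr (- p) = (d + 1) powr (- p) * s powr (- (\<nu> + 1))"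
          using True d by (simp add: powr_mult)
        moreover have "s powr \<nu> * s powr (- (\<nu> + 1)) = 1 / s"
          using True by (simp add: powr_add[symmetric] powr_minus_divide)
        moreover have "K * (u * (X * Y)) = K * X * (u * Y)" for u X Y :: real by (simp add: mult_ac)
        ultimately show ?thesis by (simp only: c_def)
      qed
      also have "\<dots> \<le> K * (s ^ k * (d + s\<^sup>2) powr (- p))"
      proof (intro mult_left_mono mult_mono)
        show "s powr \<nu> \<le> s ^ k" using True k powr_mono[of \<nu> "real k" s] by (simp add: powr_realpow)
        have "1 \<le> s\<^sup>2" using True by simp
        then have "d + s\<^sup>2 \<le> (d + 1) * s\<^sup>2" using d by (simp add: distrib_right)
        then show "((d + 1) * s\<^sup>2) powr (- p) \<le> (d + s\<^sup>2) powr (- p)"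
          using d \<nu> by (intro powr_mono2') (auto simp: p_def add_pos_nonneg)
      qed (use K True in auto)
      also have "\<dots> = student_t_density 0 \<sigma> \<nu> s * \<bar>s\<bar> ^ k"
        using True by (simp add: student_t_density_alt[OF \<nu> \<sigma>] K_def p_def d_def)
      finally show ?thesis using True c by simp
    qed simp
  qed
  then have "integrable lborel (\<lambda>s. 1 / c * (c * (1 / s * indicator {1..} s)))"
    by (rule integrable_mult_right)
  then show False using not_integrable_inverse_at_top c by simp
qed

section \<open>Moments of a random variable with Student distribution\<close>

lemma distributed_has_expectation:
  fixes X :: "'a \<Rightarrow> real" and f g :: "real \<Rightarrow> real"
  assumes X: "distributed M lborel X (\<lambda>t. ennreal (f t))" and f: "\<And>t. f t \<ge> 0"
    and g: "g \<in> borel_measurable borel"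
    and int: "has_bochner_integral lborel (\<lambda>t. f t * g t) c"
  shows "integrable M (\<lambda>\<omega>. g (X \<omega>))" "prob_space.expectation M (\<lambda>\<omega>. g (X \<omega>)) = c"
  using distributed_integrable[OF X, of g] distributed_integral[OF X, of g] f g int
  by (auto simp: has_bochner_integral_iff)

lemma Gamma_shift_down:
  fixes x :: real
  assumes "x > real m"
  shows "Gamma x = Gamma (x - real m) * (\<Prod>i = 1..m. (x - real i))"
  using assms
proof (induction m)
  case (Suc m)
  have "Gamma (x - real m) = (x - real (Suc m)) * Gamma (x - real (Suc m))"
    using Gamma_plus1[of "x - real (Suc m)"] Suc.prems by (force elim!: nonpos_Ints_cases)
  then show ?case using Suc by (simp add: mult_ac)
qed simp

lemma power_diff_le_powers:
  fixes x m :: real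
  shows "\<bar>x - m\<bar> ^ k \<le> 2 ^ k * (\<bar>x\<bar> ^ k + \<bar>m\<bar> ^ k)"
proof -
  have "\<bar>x - m\<bar> ^ k \<le> (2 * max \<bar>x\<bar> \<bar>m\<bar>) ^ k" by (intro power_mono) auto
  also have "\<dots> = 2 ^ k * (max \<bar>x\<bar> \<bar>m\<bar>) ^ k" by (simp add: power_mult_distrib)
  also have "\<dots> \<le> 2 ^ k * (\<bar>x\<bar> ^ k + \<bar>m\<bar> ^ k)"
    by (intro mult_left_mono) (auto simp: max_def)
  finally show ?thesis .
qed

theorem theorem2p2:
  fixes M :: "'a measure" and T :: "'a \<Rightarrow> real" and \<mu> \<sigma> \<nu> :: real and k :: nat
  assumes "prob_space M" and "\<nu> > 0" and "\<sigma> > 0" and "k > 0"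
  shows
    "(real k < \<nu> \<and> distributed M lborel T (\<lambda>t. ennreal (student_t_density 0 1 \<nu> t)) \<longrightarrow>
        integrable M (\<lambda>\<omega>. T \<omega> ^ k) \<and>
        prob_space.expectation M (\<lambda>\<omega>. T \<omega> ^ k) =
          (if even k
           then Gamma ((real k + 1) / 2) / sqrt pi *
                (\<nu> powr (real k / 2) / (\<Prod>i = 1..k div 2. (\<nu> / 2 - real i)))
           else 0) \<and>
        integrable M (\<lambda>\<omega>. \<bar>T \<omega>\<bar> ^ k) \<and>
        prob_space.expectation M (\<lambda>\<omega>. \<bar>T \<omega>\<bar> ^ k) =
          \<nu> powr (real k / 2) * Gamma ((real k + 1) / 2) * Gamma ((\<nu> - real k) / 2) /
          (sqrt pi * Gamma (\<nu> / 2)))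
     \<and>
     (real k < \<nu> \<and> distributed M lborel T (\<lambda>t. ennreal (student_t_density \<mu> \<sigma> \<nu> t)) \<longrightarrow>
        integrable M (\<lambda>\<omega>. T \<omega> ^ k) \<and>
        complex_of_real (prob_space.expectation M (\<lambda>\<omega>. T \<omega> ^ k)) =
          (if even k
           then complex_of_real
                  ((\<nu> / \<sigma>) powr (real k / 2) * (Gamma ((real k + 1) / 2) / sqrt pi) *
                   (Gamma (\<nu> / 2 - real k / 2) / Gamma (\<nu> / 2))) *
                hyp2F1 (complex_of_real (- (real k / 2)))
                       (complex_of_real (\<nu> / 2 - real k / 2))
                       (1 / 2)
                       (complex_of_real (- (\<mu>\<^sup>2 * \<sigma> / \<nu>)))
           else complex_of_real
                  (2 * \<mu> * (\<nu> / \<sigma>) powr ((real k - 1) / 2) *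
                   (Gamma (real k / 2 + 1) / sqrt pi) *
                   (Gamma (\<nu> / 2 - (real k - 1) / 2) / Gamma (\<nu> / 2))) *
                hyp2F1 (complex_of_real ((1 - real k) / 2))
                       (complex_of_real (\<nu> / 2 - (real k - 1) / 2))
                       (3 / 2)
                       (complex_of_real (- (\<mu>\<^sup>2 * \<sigma> / \<nu>)))) \<and>
        integrable M (\<lambda>\<omega>. (T \<omega> - \<mu>) ^ k) \<and>
        prob_space.expectation M (\<lambda>\<omega>. (T \<omega> - \<mu>) ^ k) =
          (1 + (- 1) ^ k) / 2 * (\<nu> / \<sigma>) powr (real k / 2) *
          (Gamma ((real k + 1) / 2) / sqrt pi) *
          (Gamma ((\<nu> - real k) / 2) / Gamma (\<nu> / 2)))
     \<and>
     (real k < \<nu> \<and> distributed M lborel T (\<lambda>t. ennreal (student_t_density \<mu> \<sigma> \<nu> t)) \<longrightarrow>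
        integrable M (\<lambda>\<omega>. \<bar>T \<omega>\<bar> ^ k) \<and>
        complex_of_real (prob_space.expectation M (\<lambda>\<omega>. \<bar>T \<omega>\<bar> ^ k)) =
          complex_of_real
            ((\<nu> / \<sigma>) powr (real k / 2) * (Gamma ((real k + 1) / 2) / sqrt pi) *
             (Gamma (\<nu> / 2 - real k / 2) / Gamma (\<nu> / 2))) *
          hyp2F1 (complex_of_real (- (real k / 2)))
                 (complex_of_real (\<nu> / 2 - real k / 2))
                 (1 / 2)
                 (complex_of_real (- (\<mu>\<^sup>2 * \<sigma> / \<nu>))) \<and>
        integrable M (\<lambda>\<omega>. \<bar>T \<omega> - \<mu>\<bar> ^ k) \<and>
        prob_space.expectation M (\<lambda>\<omega>. \<bar>T \<omega> - \<mu>\<bar> ^ k) =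
          (\<nu> / \<sigma>) powr (real k / 2) * (Gamma ((real k + 1) / 2) / sqrt pi) *
          (Gamma ((\<nu> - real k) / 2) / Gamma (\<nu> / 2)))
     \<and>
     (real k \<ge> \<nu> \<and> distributed M lborel T (\<lambda>t. ennreal (student_t_density \<mu> \<sigma> \<nu> t)) \<longrightarrow>
        \<not> integrable M (\<lambda>\<omega>. T \<omega> ^ k) \<and>
        \<not> integrable M (\<lambda>\<omega>. \<bar>T \<omega>\<bar> ^ k) \<and>
        \<not> integrable M (\<lambda>\<omega>. (T \<omega> - \<mu>) ^ k) \<and>
        \<not> integrable M (\<lambda>\<omega>. \<bar>T \<omega> - \<mu>\<bar> ^ k))"
proof -
  interpret prob_space M by fact
  have abs_raw: "integrable M (\<lambda>\<omega>. \<bar>T \<omega>\<bar> ^ k) \<and>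
        complex_of_real (expectation (\<lambda>\<omega>. \<bar>T \<omega>\<bar> ^ k)) =
          complex_of_real
            ((\<nu> / \<sigma>) powr (real k / 2) * (Gamma ((real k + 1) / 2) / sqrt pi) *
             (Gamma (\<nu> / 2 - real k / 2) / Gamma (\<nu> / 2))) *
          hyp2F1 (complex_of_real (- (real k / 2)))
                 (complex_of_real (\<nu> / 2 - real k / 2))
                 (1 / 2)
                 (complex_of_real (- (\<mu>\<^sup>2 * \<sigma> / \<nu>)))"
    if k: "real k < \<nu>" and T: "distributed M lborel T (\<lambda>t. ennreal (student_t_density \<mu> \<sigma> \<nu> t))"
  proof -
    obtain H where H: "hyp2F1 (of_real (- (real k / 2))) (of_real (\<nu> / 2 - real k / 2)) (1 / 2)
       (of_real (- (\<mu>\<^sup>2 * \<sigma> / \<nu>))) = of_real H"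
      and int: "has_bochner_integral lborel (\<lambda>t. student_t_density \<mu> \<sigma> \<nu> t * \<bar>t\<bar> ^ k)
       ((\<nu> / \<sigma>) powr (real k / 2) * (Gamma ((real k + 1) / 2) / sqrt pi) *
        (Gamma (\<nu> / 2 - real k / 2) / Gamma (\<nu> / 2)) * H)"
      using student_t_abs_moment[OF \<open>\<nu> > 0\<close> \<open>\<sigma> > 0\<close> k] by blast
    show ?thesis
      using distributed_has_expectation[OF T student_t_density_nonneg _ int] assms
      unfolding H by simp
  qed
  have odd_raw: "integrable M (\<lambda>\<omega>. T \<omega> ^ k) \<and>
        complex_of_real (expectation (\<lambda>\<omega>. T \<omega> ^ k)) =
        complex_of_real
                  (2 * \<mu> * (\<nu> / \<sigma>) powr ((real k - 1) / 2) *
                   (Gamma (real k / 2 + 1) / sqrt pi) *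
                   (Gamma (\<nu> / 2 - (real k - 1) / 2) / Gamma (\<nu> / 2))) *
                hyp2F1 (complex_of_real ((1 - real k) / 2))
                       (complex_of_real (\<nu> / 2 - (real k - 1) / 2))
                       (3 / 2)
                       (complex_of_real (- (\<mu>\<^sup>2 * \<sigma> / \<nu>)))"
    if k: "real k < \<nu>" and "odd k"
      and T: "distributed M lborel T (\<lambda>t. ennreal (student_t_density \<mu> \<sigma> \<nu> t))"
  proof -
    obtain n where n: "k = 2 * n + 1" using \<open>odd k\<close> by (rule oddE)
    obtain H where H: "hyp2F1 (of_real ((1 - real k) / 2)) (of_real (\<nu> / 2 - (real k - 1) / 2)) (3 / 2)
       (of_real (- (\<mu>\<^sup>2 * \<sigma> / \<nu>))) = of_real H"
      and int: "has_bochner_integral lborel (\<lambda>t. student_t_density \<mu> \<sigma> \<nu> t * t ^ k)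
       (2 * \<mu> * (\<nu> / \<sigma>) powr ((real k - 1) / 2) * (Gamma (real k / 2 + 1) / sqrt pi) *
        (Gamma (\<nu> / 2 - (real k - 1) / 2) / Gamma (\<nu> / 2)) * H)"
      using student_t_odd_moment[OF \<open>\<nu> > 0\<close> \<open>\<sigma> > 0\<close> k n] by blast
    show ?thesis
      using distributed_has_expectation[OF T student_t_density_nonneg _ int] assms
      unfolding H by simp
  qed
  have central: "integrable M (\<lambda>\<omega>. (T \<omega> - m) ^ k)"
     "expectation (\<lambda>\<omega>. (T \<omega> - m) ^ k) =
          (1 + (- 1) ^ k) / 2 * (\<nu> / s) powr (real k / 2) *
          (Gamma ((real k + 1) / 2) / sqrt pi) *
          (Gamma ((\<nu> - real k) / 2) / Gamma (\<nu> / 2))"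
    and abs_central: "integrable M (\<lambda>\<omega>. \<bar>T \<omega> - m\<bar> ^ k)"
     "expectation (\<lambda>\<omega>. \<bar>T \<omega> - m\<bar> ^ k) =
          (\<nu> / s) powr (real k / 2) *
          (Gamma ((real k + 1) / 2) / sqrt pi) *
          (Gamma ((\<nu> - real k) / 2) / Gamma (\<nu> / 2))"
    if k: "real k < \<nu>" and s: "s > 0"
      and T: "distributed M lborel T (\<lambda>t. ennreal (student_t_density m s \<nu> t))" for m s
    using distributed_has_expectation[OF T student_t_density_nonneg _
        student_t_central_moment[OF \<open>\<nu> > 0\<close> s k]]
      distributed_has_expectation[OF T student_t_density_nonneg _
        student_t_abs_central_moment[OF \<open>\<nu> > 0\<close> s k]] s \<open>\<nu> > 0\<close>
    by simp_all
  show ?thesis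
  proof (intro conjI[of "_ \<longrightarrow> _"] impI; elim conjE)
    assume k: "real k < \<nu>" and T: "distributed M lborel T (\<lambda>t. ennreal (student_t_density 0 1 \<nu> t))"
    have raw: "expectation (\<lambda>\<omega>. T \<omega> ^ k) = Gamma ((real k + 1) / 2) / sqrt pi *
                (\<nu> powr (real k / 2) / (\<Prod>i = 1..k div 2. (\<nu> / 2 - real i)))" if "even k"
    proof -
      obtain n where n: "k = 2 * n" using \<open>even k\<close> by (rule evenE)
      have eq: "\<nu> / 2 - real n = (\<nu> - real k) / 2" by (simp add: n diff_divide_distrib)
      have "Gamma (\<nu> / 2) = Gamma ((\<nu> - real k) / 2) * (\<Prod>i = 1..k div 2. (\<nu> / 2 - real i))"
        using Gamma_shift_down[of n "\<nu> / 2"] k unfolding eq by (simp add: n)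
      moreover have "Gamma ((\<nu> - real k) / 2) > 0" using k by (intro Gamma_real_pos) simp
      ultimately have "Gamma ((\<nu> - real k) / 2) / Gamma (\<nu> / 2) = 1 / (\<Prod>i = 1..k div 2. (\<nu> / 2 - real i))"
        by simp
      then show ?thesis using central(2)[OF k _ T] \<open>even k\<close> by simp
    qed
    show "integrable M (\<lambda>\<omega>. T \<omega> ^ k) \<and>
        expectation (\<lambda>\<omega>. T \<omega> ^ k) =
          (if even k
           then Gamma ((real k + 1) / 2) / sqrt pi *
                (\<nu> powr (real k / 2) / (\<Prod>i = 1..k div 2. (\<nu> / 2 - real i)))
           else 0) \<and>
        integrable M (\<lambda>\<omega>. \<bar>T \<omega>\<bar> ^ k) \<and>
        expectation (\<lambda>\<omega>. \<bar>T \<omega>\<bar> ^ k) =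
          \<nu> powr (real k / 2) * Gamma ((real k + 1) / 2) * Gamma ((\<nu> - real k) / 2) /
          (sqrt pi * Gamma (\<nu> / 2))"
      using raw central[OF k _ T] abs_central[OF k _ T] by auto
  next
    assume k: "real k < \<nu>" and T: "distributed M lborel T (\<lambda>t. ennreal (student_t_density \<mu> \<sigma> \<nu> t))"
    show "integrable M (\<lambda>\<omega>. T \<omega> ^ k) \<and>
        complex_of_real (expectation (\<lambda>\<omega>. T \<omega> ^ k)) =
          (if even k
           then complex_of_real
                  ((\<nu> / \<sigma>) powr (real k / 2) * (Gamma ((real k + 1) / 2) / sqrt pi) *
                   (Gamma (\<nu> / 2 - real k / 2) / Gamma (\<nu> / 2))) *
                hyp2F1 (complex_of_real (- (real k / 2)))
                       (complex_of_real (\<nu> / 2 - real k / 2))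
                       (1 / 2)
                       (complex_of_real (- (\<mu>\<^sup>2 * \<sigma> / \<nu>)))
           else complex_of_real
                  (2 * \<mu> * (\<nu> / \<sigma>) powr ((real k - 1) / 2) *
                   (Gamma (real k / 2 + 1) / sqrt pi) *
                   (Gamma (\<nu> / 2 - (real k - 1) / 2) / Gamma (\<nu> / 2))) *
                hyp2F1 (complex_of_real ((1 - real k) / 2))
                       (complex_of_real (\<nu> / 2 - (real k - 1) / 2))
                       (3 / 2)
                       (complex_of_real (- (\<mu>\<^sup>2 * \<sigma> / \<nu>)))) \<and>
        integrable M (\<lambda>\<omega>. (T \<omega> - \<mu>) ^ k) \<and>
        expectation (\<lambda>\<omega>. (T \<omega> - \<mu>) ^ k) =
          (1 + (- 1) ^ k) / 2 * (\<nu> / \<sigma>) powr (real k / 2) *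
          (Gamma ((real k + 1) / 2) / sqrt pi) *
          (Gamma ((\<nu> - real k) / 2) / Gamma (\<nu> / 2))"
    proof (cases "even k")
      case True
      then have "\<bar>x\<bar> ^ k = x ^ k" for x :: real by (rule power_even_abs)
      then show ?thesis
        using abs_raw[OF k T] central[OF k \<open>\<sigma> > 0\<close> T] True by (simp only: if_True)
    next
      case False
      then show ?thesis
        using odd_raw[OF k False T] central[OF k \<open>\<sigma> > 0\<close> T] by (simp only: if_False)
    qed
  next
    assume k: "real k < \<nu>" and T: "distributed M lborel T (\<lambda>t. ennreal (student_t_density \<mu> \<sigma> \<nu> t))"
    show "integrable M (\<lambda>\<omega>. \<bar>T \<omega>\<bar> ^ k) \<and>
        complex_of_real (expectation (\<lambda>\<omega>. \<bar>T \<omega>\<bar> ^ k)) =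
          complex_of_real
            ((\<nu> / \<sigma>) powr (real k / 2) * (Gamma ((real k + 1) / 2) / sqrt pi) *
             (Gamma (\<nu> / 2 - real k / 2) / Gamma (\<nu> / 2))) *
          hyp2F1 (complex_of_real (- (real k / 2)))
                 (complex_of_real (\<nu> / 2 - real k / 2))
                 (1 / 2)
                 (complex_of_real (- (\<mu>\<^sup>2 * \<sigma> / \<nu>))) \<and>
        integrable M (\<lambda>\<omega>. \<bar>T \<omega> - \<mu>\<bar> ^ k) \<and>
        expectation (\<lambda>\<omega>. \<bar>T \<omega> - \<mu>\<bar> ^ k) =
          (\<nu> / \<sigma>) powr (real k / 2) * (Gamma ((real k + 1) / 2) / sqrt pi) *
          (Gamma ((\<nu> - real k) / 2) / Gamma (\<nu> / 2))"
      using abs_raw[OF k T] abs_central[OF k \<open>\<sigma> > 0\<close> T] by blast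
  next
    assume k: "real k \<ge> \<nu>" and T: "distributed M lborel T (\<lambda>t. ennreal (student_t_density \<mu> \<sigma> \<nu> t))"
    have T_meas[measurable]: "T \<in> borel_measurable M"
      using distributed_measurable[OF T] by simp
    have nint: "\<not> integrable M (\<lambda>\<omega>. \<bar>T \<omega> - \<mu>\<bar> ^ k)"
      using distributed_integrable[OF T, of "\<lambda>t. \<bar>t - \<mu>\<bar> ^ k"]
        student_t_moment_not_integrable[OF \<open>\<nu> > 0\<close> \<open>\<sigma> > 0\<close> k] student_t_density_nonneg assms
      by simp
    have nint_abs: "\<not> integrable M (\<lambda>\<omega>. \<bar>T \<omega>\<bar> ^ k)"
    proof
      assume "integrable M (\<lambda>\<omega>. \<bar>T \<omega>\<bar> ^ k)"
      then have "integrable M (\<lambda>\<omega>. 2 ^ k * (\<bar>T \<omega>\<bar> ^ k + \<bar>\<mu>\<bar> ^ k))" by simp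
      then have "integrable M (\<lambda>\<omega>. \<bar>T \<omega> - \<mu>\<bar> ^ k)"
        by (rule Bochner_Integration.integrable_bound) (auto intro!: AE_I2 simp: power_diff_le_powers)
      with nint show False ..
    qed
    show "\<not> integrable M (\<lambda>\<omega>. T \<omega> ^ k) \<and>
        \<not> integrable M (\<lambda>\<omega>. \<bar>T \<omega>\<bar> ^ k) \<and>
        \<not> integrable M (\<lambda>\<omega>. (T \<omega> - \<mu>) ^ k) \<and>
        \<not> integrable M (\<lambda>\<omega>. \<bar>T \<omega> - \<mu>\<bar> ^ k)"
      using nint nint_abs integrable_abs[of M "\<lambda>\<omega>. T \<omega> ^ k"] integrable_abs[of M "\<lambda>\<omega>. (T \<omega> - \<mu>) ^ k"]
      by (auto simp: power_abs)
  qed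
qed

end
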